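(* Let $\mu\in\mathcal M_+$, $\mu\ne\delta_0$, and let $L\in\mathcal R_0$. Then $$\mu\big((x,+\infty)\big)\sim x^{-1}L(x)$$ is equivalent to $$x\mapsto\frac{1}{S_\mu(-1/x)}\in\Pi_M(1),$$ where $M(x):=L\big((x-1)/S_\mu(-1/x)\big)\in\mathcal R_0$.
   Context: $\mathcal M_+$ is the set of Borel probability measures on $[0,+\infty)$. $f(x)\sim g(x)$ means $f(x)/g(x)\to1$ as $x\to+\infty$. $\mathcal R_0$ is the class of slowly varying functions: (positive, measurable) $f$ on a neighborhood of $+\infty$ with $f(\lambda x)/f(x)\to1$ as $x\to+\infty$ for every $\lambda>0$. For $M\in\mathcal R_0$ and $c\in\mathbb R$, $f\in\Pi_M(c)$ means that $\lim_{x\to+\infty}\frac{f(\lambda x)-f(x)}{M(x)}=c\log\lambda$ for all $\lambda>0$ (the notation presupposes that $M$ is slowly varying). For $\mu\in\mathcal M_+$, $\mu\ne\delta_0$, put $\delta=\mu(\{0\})<1$ and $\psi_\mu(z)=\int_{[0,+\infty)}\frac{zt}{1-zt}\,\mu(\mathrm dt)$, $z<0$. The map $\psi_\mu:(-\infty,0)\to(\delta-1,0)$ is invertible with inverse $\chi_\mu$, and the $S$-transform is $S_\mu(z)=\frac{z+1}{z}\chi_\mu(z)$, $z\in(\delta-1,0)$. *)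

theory Defs
  imports "HOL-Probability.Probability" "HOL-Library.Landau_Symbols"
begin

text \<open>Borel probability measures on the half-line, with underlying space \<open>{0..}\<close> itself.\<close>

definition M_plus :: "real measure set" where
  "M_plus = {\<mu>. prob_space \<mu> \<and> sets \<mu> = sets (restrict_space borel {0..})}"

definition delta_zero :: "real measure" where
  "delta_zero = return (restrict_space borel {0..}) 0"

text \<open>Functions on a neighbourhood of infinity are represented by total functions; their values
  to the left of some threshold are irrelevant. As usual in regular variation, measurability
  means Lebesgue measurability.\<close>

definition slowly_varying :: "(real \<Rightarrow> real) set" where
  "slowly_varying = {f.
     (\<exists>a. f \<in> borel_measurable (lebesgue_on {a..}) \<and> (\<forall>x\<ge>a. f x > 0)) \<and>
     (\<forall>l>0. ((\<lambda>x. f (l * x) / f x) \<longlongrightarrow> 1) at_top)}"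

text \<open>Membership includes the requirement that the auxiliary function \<open>M\<close> is slowly varying.\<close>

definition Pi_class :: "(real \<Rightarrow> real) \<Rightarrow> real \<Rightarrow> (real \<Rightarrow> real) set" where
  "Pi_class M c = {f. M \<in> slowly_varying \<and>
     (\<forall>l>0. ((\<lambda>x. (f (l * x) - f x) / M x) \<longlongrightarrow> c * ln l) at_top)}"

definition psi_transform :: "real measure \<Rightarrow> real \<Rightarrow> real" where
  "psi_transform \<mu> z = (LINT t|\<mu>. z * t / (1 - z * t))"

text \<open>For \<open>\<mu> \<in> M_plus\<close> other than \<open>delta_zero\<close>, the map \<open>psi_transform \<mu>\<close> is a bijection from
  \<open>{..<0}\<close> onto \<open>{measure \<mu> {0} - 1<..<0}\<close>. The two functions below are meaningful only
  on the latter interval.\<close>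

definition chi_transform :: "real measure \<Rightarrow> real \<Rightarrow> real" where
  "chi_transform \<mu> = the_inv_into {..<0} (psi_transform \<mu>)"

definition S_transform :: "real measure \<Rightarrow> real \<Rightarrow> real" where
  "S_transform \<mu> z = (z + 1) / z * chi_transform \<mu> z"

end

theory Submission
  imports Defs "HOL-Real_Asymp.Real_Asymp"
begin

text \<open>For \<open>y > 0\<close> put \<open>P(y) = \<integral> ty/(t+y) \<mu>(dt)\<close> (\<open>parallel_mean\<close>) and \<open>x = y/P(y)\<close> (\<open>level\<close>), an increasing
function of \<open>y\<close> that tends to infinity.
Then \<open>\<psi>(-1/y) = -P(y)/y = -1/x\<close>, hence \<open>\<chi>(-1/x) = -1/y\<close> and \<open>S(-1/x) = (x-1)/y\<close>. So the argument of
\<open>L\<close> in the definition of \<open>M\<close> is just \<open>y\<close>, that is \<open>M(x) = L(y)\<close>, and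
\<open>1/S(-1/x) = y/(x-1) = P(y) \<cdot> x/(x-1)\<close>. Up to the factor \<open>x/(x-1)\<close> and the change of
variables between \<open>x\<close> and \<open>y\<close>, the claim says that the tail \<open>\<mu>((y,\<infinity>))\<close> is asymptotic to
\<open>L(y)/y\<close> iff \<open>P(ly) - P(y)\<close> is asymptotic to \<open>L(y) log l\<close> for every \<open>l \<noteq> 1\<close>.
The bridge between the two sides is the derivative \<open>P'(y) = \<integral> (t/(t+y))\<^sup>2 \<mu>(dt)\<close>
(\<open>stieltjes 0\<close>): both are equivalent to \<open>y P'(y) \<sim> L(y)\<close>.

\<^bold>\<open>Tail and derivative\<close> (\<open>tail_iff_stieltjes\<close>). Integration by parts writes \<open>P'(y)/tail(y)\<close> as
\<open>\<integral> 2s/(1+s)\<^sup>3 \<cdot> tail(sy)/tail(y) ds\<close>. If the tail is regularly varying of index \<open>-1\<close>,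
the integrand tends to \<open>2/(1+s)\<^sup>3\<close>, whose integral is \<open>1\<close>; as the tail is monotone, an elementary
bound of Potter type dominates the integrand (\<open>stieltjes_of_tail\<close>). The converse
(\<open>tail_of_stieltjes\<close>) follows Karamata's method. Monotone density, applied repeatedly, passes from
\<open>P'\<close> to all higher derivatives of \<open>P\<close>. In the variable \<open>u = y/(t+y)\<close> this means that the measures
\<open>y/L(y) \<cdot> (1-u)\<^sup>2 d\<mu>\<close> converge to Lebesgue measure on \<open>[0,1]\<close> when tested against powers of \<open>u\<close>, thus by
Weierstrass against continuous functions, thus against \<open>1/(1-u)\<^sup>2\<close> restricted to \<open>u < 1/2\<close>. That
function has integral \<open>1\<close> and represents the tail.

\<^bold>\<open>Derivative and the class\<close> \<open>\<Pi>\<close> (\<open>Pi_of_stieltjes\<close>, \<open>stieltjes_of_Pi\<close>). As \<open>P\<close> is concave,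
integrating and monotone density relate \<open>y P'(y) \<sim> L(y)\<close> to the increments of \<open>P\<close>. To change
variables one needs that the inverse \<open>y(x)\<close> of \<open>level\<close> satisfies \<open>y(lx)/y(x) \<rightarrow> l\<close>; this holds since
functions in \<open>\<Pi>\<close> are slowly varying, applied to \<open>P\<close> in one direction and to \<open>x \<mapsto> 1/S(-1/x)\<close>
in the other. The factor \<open>x/(x-1)\<close> is harmless because \<open>f(x) = o(x M(x))\<close> for monotone \<open>f\<close> in the
class \<open>\<Pi>\<close> (\<open>Pi_small_over_identity\<close>).\<close>

section \<open>Regular variation of monotone functions\<close>

text \<open>Monotone functions of \<open>m\<close> that converge pointwise to a function continuous at \<open>l\<close> converge
continuously there: squeeze \<open>q x\<close> between two fixed values of \<open>m\<close> close to \<open>l\<close>. This replaces the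
uniform convergence theorem for slowly varying functions.\<close>

lemma tendsto_compose_monotone_family:
  fixes \<Phi> :: "real \<Rightarrow> 'a \<Rightarrow> real" and \<phi> :: "real \<Rightarrow> real"
  assumes lim: "\<And>m. m > 0 \<Longrightarrow> ((\<lambda>x. \<Phi> m x) \<longlongrightarrow> \<phi> m) F"
    and mono: "\<forall>\<^sub>F x in F. mono_on {0<..} (\<lambda>m. \<Phi> m x)"
    and cont: "isCont \<phi> l" and l: "l > 0" and q: "(q \<longlongrightarrow> l) F"
  shows "((\<lambda>x. \<Phi> (q x) x) \<longlongrightarrow> \<phi> l) F"
proof (rule order_tendstoI)
  fix a assume a: "a < \<phi> l"
  have "\<forall>\<^sub>F m in at_left l. a < \<phi> m \<and> 0 < m \<and> m < l"
    using cont l a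
    by (intro eventually_conj order_tendstoD(1)[of \<phi> "\<phi> l"])
      (auto simp: isCont_def eventually_at_left_field intro: filterlim_mono at_le)
  then obtain m where m: "a < \<phi> m" "0 < m" "m < l"
    using eventually_happens'[OF trivial_limit_at_left_real] by blast
  show "\<forall>\<^sub>F x in F. a < \<Phi> (q x) x"
    using order_tendstoD(1)[OF lim[OF m(2)] m(1)] order_tendstoD(1)[OF q m(3)] mono
  proof eventually_elim
    case (elim x)
    then have "\<Phi> m x \<le> \<Phi> (q x) x"
      using m by (auto intro!: mono_onD[of "{0<..}" "\<lambda>m. \<Phi> m x"])
    then show ?case using elim by simp
  qed
next
  fix b assume b: "\<phi> l < b"
  have "\<forall>\<^sub>F m in at_right l. \<phi> m < b \<and> l < m"
    using cont l b
    by (intro eventually_conj order_tendstoD(2)[of \<phi> "\<phi> l"])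
      (auto simp: isCont_def eventually_at_right_less intro: filterlim_mono at_le)
  then obtain m where m: "\<phi> m < b" "l < m"
    using eventually_happens'[OF trivial_limit_at_right_real] by blast
  have "m > 0" using m l by simp
  show "\<forall>\<^sub>F x in F. \<Phi> (q x) x < b"
    using order_tendstoD(2)[OF lim[OF \<open>m > 0\<close>] m(1)] order_tendstoD(2)[OF q m(2)]
      order_tendstoD(1)[OF q l] mono
  proof eventually_elim
    case (elim x)
    then have "\<Phi> (q x) x \<le> \<Phi> m x"
      using m \<open>m > 0\<close> by (auto intro!: mono_onD[of "{0<..}" "\<lambda>m. \<Phi> m x"])
    then show ?case using elim by simp
  qed
qed

text \<open>The monotone density theorem. The two bounds say that \<open>A\<close> is convex with slope \<open>-B\<close>. Difference quotients of
\<open>A\<close> over \<open>[y, ly]\<close> bound \<open>B(y)\<close> from one side for \<open>l > 1\<close> and from the other for \<open>l < 1\<close>; both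
bounds tend to \<open>d\<close> as \<open>l\<close> tends to \<open>1\<close>. The second end point is allowed to be only asymptotically \<open>l y\<close>,
as happens when \<open>y\<close> is itself a function of another variable.\<close>

lemma monotone_density:
  fixes A B \<phi> :: "real \<Rightarrow> real" and y K :: "'a \<Rightarrow> real" and q :: "real \<Rightarrow> 'a \<Rightarrow> real"
  assumes upper: "\<And>a b. 0 < a \<Longrightarrow> a < b \<Longrightarrow> A a - A b \<le> (b - a) * B a"
    and lower: "\<And>a b. 0 < a \<Longrightarrow> a < b \<Longrightarrow> (b - a) * B b \<le> A a - A b"
    and K: "\<forall>\<^sub>F x in F. K x > 0" and y: "\<forall>\<^sub>F x in F. y x > 0"
    and q: "\<And>l. l > 0 \<Longrightarrow> ((\<lambda>x. q l x / y x) \<longlongrightarrow> l) F"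
    and A: "\<And>l. l > 0 \<Longrightarrow> ((\<lambda>x. (A (y x) - A (q l x)) / K x) \<longlongrightarrow> \<phi> l) F"
    and \<phi>: "(\<phi> has_real_derivative d) (at 1)" "\<phi> 1 = 0"
  shows "((\<lambda>x. y x * B (y x) / K x) \<longlongrightarrow> d) F"
proof -
  have quot: "((\<lambda>l. \<phi> l / (l - 1)) \<longlongrightarrow> d) (at 1)"
    using \<phi> by (simp add: DERIV_def has_field_derivative_iff)
  have lim: "((\<lambda>x. (A (y x) - A (q l x)) / K x / (q l x / y x - 1)) \<longlongrightarrow> \<phi> l / (l - 1)) F"
    if "l > 0" "l \<noteq> 1" for l
    using that by (intro tendsto_intros A q) auto
  show ?thesis
  proof (rule order_tendstoI)
    fix a assume a: "a < d"
    have "\<forall>\<^sub>F l in at_right 1. a < \<phi> l / (l - 1) \<and> 1 < l"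
      using quot a
      by (intro eventually_conj order_tendstoD(1)[of "\<lambda>l. \<phi> l / (l - 1)" d])
        (auto simp: eventually_at_right_less intro: filterlim_mono at_le)
    then obtain l where l: "a < \<phi> l / (l - 1)" "1 < l"
      using eventually_happens'[OF trivial_limit_at_right_real] by blast
    have l0: "l > 0" "l \<noteq> 1" using l by auto
    show "\<forall>\<^sub>F x in F. a < y x * B (y x) / K x"
      using order_tendstoD(1)[OF lim[OF l0] l(1)] order_tendstoD(1)[OF q[OF l0(1)] l(2)] K y
    proof eventually_elim
      case (elim x)
      have qy: "q l x > y x" using elim by (simp add: field_simps)
      have "A (y x) - A (q l x) \<le> (q l x - y x) * B (y x)"
        using upper[OF elim(4) qy] .
      then have "(A (y x) - A (q l x)) / (K x * ((q l x - y x) / y x))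
          \<le> (q l x - y x) * B (y x) / (K x * ((q l x - y x) / y x))"
        using elim qy by (intro divide_right_mono) auto
      also have "\<dots> = y x * B (y x) / K x" using elim qy by (simp add: field_simps)
      also have "(A (y x) - A (q l x)) / (K x * ((q l x - y x) / y x))
          = (A (y x) - A (q l x)) / K x / (q l x / y x - 1)"
        using elim by (simp add: diff_divide_distrib)
      finally show ?case using elim by simp
    qed
  next
    fix b assume b: "d < b"
    have "\<forall>\<^sub>F l in at_left 1. \<phi> l / (l - 1) < b \<and> 0 < l \<and> l < 1"
      using quot b
      by (intro eventually_conj order_tendstoD(2)[of "\<lambda>l. \<phi> l / (l - 1)" d])
        (auto simp: eventually_at_left_field intro: filterlim_mono at_le zero_less_one)
    then obtain l where l: "\<phi> l / (l - 1) < b" "0 < l" "l < 1"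
      using eventually_happens'[OF trivial_limit_at_left_real] by blast
    have l0: "l > 0" "l \<noteq> 1" using l by auto
    show "\<forall>\<^sub>F x in F. y x * B (y x) / K x < b"
      using order_tendstoD(2)[OF lim[OF l0] l(1)] order_tendstoD(2)[OF q[OF l0(1)] l(3)] 
        order_tendstoD(1)[OF q[OF l0(1)] l(2)] K y
    proof eventually_elim
      case (elim x)
      have qy: "q l x < y x" "q l x > 0" using elim by (auto simp: field_simps zero_less_divide_iff)
      have "(y x - q l x) * B (y x) \<le> A (q l x) - A (y x)"
        using lower[OF qy(2,1)] .
      then have "(y x - q l x) * B (y x) / (K x * ((y x - q l x) / y x))
          \<le> (A (q l x) - A (y x)) / (K x * ((y x - q l x) / y x))"
        using elim qy by (intro divide_right_mono) auto
      also have "(y x - q l x) * B (y x) / (K x * ((y x - q l x) / y x)) = y x * B (y x) / K x"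
        using elim qy by (simp add: field_simps)
      also have "(A (q l x) - A (y x)) / (K x * ((y x - q l x) / y x))
          = (A (y x) - A (q l x)) / K x / (q l x / y x - 1)"
      proof -
        have "q l x / y x - 1 = - ((y x - q l x) / y x)"
          using elim by (simp add: diff_divide_distrib)
        then show ?thesis by (metis divide_divide_eq_left divide_minus_right minus_diff_eq minus_divide_left)
      qed
      finally show ?case using elim by simp
    qed
  qed
qed

text \<open>A bound of Potter type: growth by at most \<open>e\<^sup>p\<close> over each factor \<open>e\<close> in the argument
gives growth of order \<open>x\<^sup>p\<close> by iteration; the extra \<open>e\<^sup>p\<close> pays for the last, incomplete, step.\<close>

lemma power_growth_bound:
  fixes F :: "real \<Rightarrow> real"
  assumes X: "X > 0" and p: "p \<ge> 0" and nonneg: "\<And>x. x \<ge> X \<Longrightarrow> F x \<ge> 0"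
    and step: "\<And>x u. x \<ge> X \<Longrightarrow> 1 \<le> u \<Longrightarrow> u \<le> exp 1 \<Longrightarrow> F (u * x) \<le> exp p * F x"
    and x: "x \<ge> X"
  shows "F x \<le> exp p * F X * (x / X) powr p"
proof -
  define n where "n = nat \<lfloor>ln (x / X)\<rfloor>"
  have ln0: "ln (x / X) \<ge> 0" using X x by simp
  have n: "real n \<le> ln (x / X)" "ln (x / X) \<le> real n + 1"
    using ln0 unfolding n_def by linarith+
  have iter: "F (exp 1 ^ k * z) \<le> exp p ^ k * F z" if "z \<ge> X" for k z
  proof (induction k)
    case (Suc k)
    have "exp 1 ^ k * z \<ge> 1 * X" using that X by (intro mult_mono) auto
    then have "F (exp 1 * (exp 1 ^ k * z)) \<le> exp p * F (exp 1 ^ k * z)"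
      by (intro step) auto
    also have "\<dots> \<le> exp p * (exp p ^ k * F z)" using Suc by simp
    finally show ?case by (simp add: mult_ac)
  qed simp
  \<comment> \<open>the mantissa: what is left of \<open>x/X\<close> after \<open>n\<close> whole steps of size \<open>e\<close>\<close>
  define u where "u = (x / X) / exp 1 ^ n"
  have u: "1 \<le> u" "u \<le> exp 1"
  proof -
    have e: "x / X = exp (ln (x / X))" using X x by simp
    have "u = exp (ln (x / X) - n)" unfolding u_def
      by (subst e) (simp add: exp_diff exp_of_nat_mult[symmetric] power_one_right)
    then show "1 \<le> u" "u \<le> exp 1" using n by auto
  qed
  have "x = exp 1 ^ n * (u * X)" using X by (simp add: u_def)
  then have "F x \<le> exp p ^ n * F (u * X)" using iter[of "u * X" n] u X by simp
  also have "\<dots> \<le> exp p ^ n * (exp p * F X)" using step[of X u] u by simp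
  also have "exp p ^ n = exp (p * n)" by (simp add: exp_of_nat_mult[symmetric] mult.commute)
  also have "\<dots> * (exp p * F X) \<le> (x / X) powr p * (exp p * F X)"
  proof (rule mult_right_mono)
    show "exp (p * n) \<le> (x / X) powr p" using n p X x by (simp add: powr_def mult_left_mono)
  qed (use nonneg[of X] in auto)
  finally show ?thesis by (simp add: mult_ac)
qed

text \<open>Going down from \<open>x\<close> by the factor \<open>e\<^bsup>-k\<^esup>\<close> costs \<open>k M(x)\<close> asymptotically, and what is left is still
nonnegative. Hence \<open>f(x)/M(x)\<close> eventually exceeds every \<open>k - 1\<close>.\<close>

lemma Pi_auxiliary_negligible:
  fixes f M :: "real \<Rightarrow> real"
  assumes f: "\<forall>\<^sub>F x in at_top. f x \<ge> 0" and M: "\<forall>\<^sub>F x in at_top. M x > 0"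
    and Pi: "\<And>l. l > 0 \<Longrightarrow> ((\<lambda>x. (f (l * x) - f x) / M x) \<longlongrightarrow> ln l) at_top"
  shows "((\<lambda>x. M x / f x) \<longlongrightarrow> 0) at_top"
proof -
  have "filterlim (\<lambda>x. f x / M x) at_top at_top"
    unfolding filterlim_at_top
  proof
    fix Z :: real
    have "((\<lambda>x. (f (exp (- (Z + 1)) * x) - f x) / M x) \<longlongrightarrow> - (Z + 1)) at_top"
      using Pi[of "exp (- (Z + 1))"] by simp
    then have 1: "\<forall>\<^sub>F x in at_top. (f (exp (- (Z + 1)) * x) - f x) / M x < - Z"
      by (rule order_tendstoD) simp
    have 2: "\<forall>\<^sub>F x in at_top. f (exp (- (Z + 1)) * x) \<ge> 0"
      using f by (rule eventually_compose_filterlim) real_asymp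
    show "\<forall>\<^sub>F x in at_top. Z \<le> f x / M x"
      using 1 2 M
    proof eventually_elim
      case (elim x)
      have "f (exp (- (Z + 1)) * x) - f x < - Z * M x"
        using elim by (simp add: divide_less_eq)
      then have "Z * M x \<le> f x" using elim by linarith
      then show ?case using elim by (simp add: le_divide_eq)
    qed
  qed
  then have "((\<lambda>x. inverse (f x / M x)) \<longlongrightarrow> 0) at_top"
    by (rule tendsto_inverse_0_at_top)
  then show ?thesis by simp
qed

lemma Pi_imp_slow_variation:
  fixes f M :: "real \<Rightarrow> real"
  assumes f: "\<forall>\<^sub>F x in at_top. f x > 0" and M: "\<forall>\<^sub>F x in at_top. M x > 0"
    and Pi: "\<And>l. l > 0 \<Longrightarrow> ((\<lambda>x. (f (l * x) - f x) / M x) \<longlongrightarrow> ln l) at_top"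
    and l: "l > 0"
  shows "((\<lambda>x. f (l * x) / f x) \<longlongrightarrow> 1) at_top"
proof -
  have "((\<lambda>x. M x / f x) \<longlongrightarrow> 0) at_top"
    using f by (intro Pi_auxiliary_negligible M Pi) (auto elim: eventually_mono)
  then have "((\<lambda>x. 1 + (f (l * x) - f x) / M x * (M x / f x)) \<longlongrightarrow> 1 + ln l * 0) at_top"
    by (intro tendsto_intros Pi l)
  moreover have "\<forall>\<^sub>F x in at_top. 1 + (f (l * x) - f x) / M x * (M x / f x) = f (l * x) / f x"
    using f M by eventually_elim (simp add: field_simps)
  ultimately show ?thesis
      using Lim_transform_eventually by fastforce
qed

text \<open>The increment \<open>N(x) = f(e\<^sup>4x) - f(x)\<close> is asymptotic to \<open>4 M(x)\<close>. Both \<open>f\<close> and \<open>M\<close> vary slowly, so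
\<open>f/N\<close> should grow less than any power; since \<open>f\<close> is monotone, \<open>f/N\<close> at points of \<open>[x, ex]\<close>
is at most \<open>f(ex)/(f(e\<^sup>4x) - f(ex))\<close>, which is about \<open>4/3\<close> times its value at \<open>x\<close>. As
\<open>4/3 < e\<^bsup>1/2\<^esup>\<close>, the growth bound yields \<open>f/N = O(x\<^bsup>1/2\<^esup>)\<close>.\<close>

lemma Pi_small_over_identity:
  fixes f M :: "real \<Rightarrow> real"
  assumes f: "\<forall>\<^sub>F x in at_top. f x > 0" and M: "\<forall>\<^sub>F x in at_top. M x > 0"
    and mono: "mono_on {a..} f"
    and Pi: "\<And>l. l > 0 \<Longrightarrow> ((\<lambda>x. (f (l * x) - f x) / M x) \<longlongrightarrow> ln l) at_top"
  shows "((\<lambda>x. f x / (x * M x)) \<longlongrightarrow> 0) at_top"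
proof -
  define N where "N = (\<lambda>x. f (exp 4 * x) - f x)"
  define G where "G = (\<lambda>x. f x / N x)"
  have NM: "((\<lambda>x. N x / M x) \<longlongrightarrow> 4) at_top"
    using Pi[of "exp 4"] by (simp add: N_def)
  have slow: "((\<lambda>x. f (exp 1 * x) / f x) \<longlongrightarrow> 1) at_top"
    by (rule Pi_imp_slow_variation[OF f M Pi]) auto
  have gap: "((\<lambda>x. (f (exp 4 * x) - f (exp 1 * x)) / M x) \<longlongrightarrow> 3) at_top"
    using tendsto_diff[OF Pi[of "exp 4"] Pi[of "exp 1"]] by (simp add: diff_divide_distrib)
  have "((\<lambda>x. f (exp 1 * x) / f x * (N x / M x) / ((f (exp 4 * x) - f (exp 1 * x)) / M x))
      \<longlongrightarrow> 1 * 4 / 3) at_top"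
    by (intro tendsto_intros slow NM gap) auto
  then have 1: "\<forall>\<^sub>F x in at_top.
      f (exp 1 * x) / f x * (N x / M x) / ((f (exp 4 * x) - f (exp 1 * x)) / M x) < 3 / 2"
    by (rule order_tendstoD) simp
  have 2: "\<forall>\<^sub>F x in at_top. N x / M x > 0" using NM by (rule order_tendstoD) simp
  have 3: "\<forall>\<^sub>F x in at_top. (f (exp 4 * x) - f (exp 1 * x)) / M x > 0"
    using gap by (rule order_tendstoD) simp
  have "\<forall>\<^sub>F x in at_top. x > 0 \<and> x \<ge> a \<and> f x > 0 \<and> N x > 0 \<and> f (exp 4 * x) > f (exp 1 * x)
      \<and> f (exp 1 * x) / (f (exp 4 * x) - f (exp 1 * x)) \<le> 3 / 2 * G x"
    using 1 2 3 f M eventually_gt_at_top[of 0] eventually_ge_at_top[of a]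
  proof eventually_elim
    case (elim x)
    have N: "N x > 0" using elim by (simp add: zero_less_divide_iff)
    have g: "f (exp 4 * x) > f (exp 1 * x)" using elim by (simp add: zero_less_divide_iff)
    define D where "D = f (exp 4 * x) - f (exp 1 * x)"
    have D: "D > 0" using g by (simp add: D_def)
    have "f (exp 1 * x) / f x * (N x / M x) / (D / M x) = f (exp 1 * x) / D * (N x / f x)"
      using elim D by (simp add: field_simps)
    then have "f (exp 1 * x) / D * (N x / f x) < 3 / 2" using elim(1) by (simp add: D_def)
    then have "f (exp 1 * x) / D \<le> 3 / 2 * G x"
      using N elim D by (simp add: G_def field_simps)
    then show ?case using N g elim by (auto simp: D_def)
  qed
  then obtain X where X: "\<And>x. x \<ge> X \<Longrightarrow> x > 0 \<and> x \<ge> a \<and> f x > 0 \<and> N x > 0 \<and>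
      f (exp 4 * x) > f (exp 1 * x) \<and>
      f (exp 1 * x) / (f (exp 4 * x) - f (exp 1 * x)) \<le> 3 / 2 * G x"
    by (auto simp: eventually_at_top_linorder)
  have X0: "X > 0" using X[of X] by simp
  have G0: "G x \<ge> 0" if "x \<ge> X" for x using X[OF that] by (auto simp: G_def)
  have bound: "G x \<le> exp (1/2) * G X * (x / X) powr (1/2)" if "x \<ge> X" for x
  proof (rule power_growth_bound[OF X0 _ G0 _ that])
    fix x u :: real assume x: "x \<ge> X" and u: "1 \<le> u" "u \<le> exp 1"
    have x0: "x > 0" "x \<ge> a" using X[OF x] by auto
    have ux: "x \<le> u * x" "u * x \<le> exp 1 * x" using u x0 by auto
    have e4: "x \<le> exp 4 * x" "exp 4 * x \<le> exp 4 * (u * x)" using ux x0 by simp_all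
    have ax: "a \<le> u * x" "a \<le> exp 1 * x" using ux x0 by linarith+
    have m: "f (u * x) \<le> f (exp 1 * x)"
      by (rule mono_onD[OF mono]) (use ux ax in simp_all)
    have ax4: "a \<le> exp 4 * x" "a \<le> exp 4 * (u * x)" using e4 x0 by linarith+
    have m': "f (exp 4 * x) \<le> f (exp 4 * (u * x))"
      by (rule mono_onD[OF mono]) (use e4 ax4 in simp_all)
    have "0 < f (u * x)" using X[of "u * x"] ux x by auto
    have "G (u * x) \<le> f (exp 1 * x) / (f (exp 4 * x) - f (exp 1 * x))"
      unfolding G_def N_def using X[OF x] m m' \<open>0 < f (u * x)\<close> by (intro frac_le) auto
    also have "\<dots> \<le> 3 / 2 * G x" using X[OF x] by simp
    also have "\<dots> \<le> exp (1/2) * G x"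
      using G0[OF x] exp_ge_add_one_self[of "1/2"] by (intro mult_right_mono) auto
    finally show "G (u * x) \<le> exp (1/2) * G x" .
  qed auto
  have "((\<lambda>x. G x / x) \<longlongrightarrow> 0) at_top"
  proof (rule tendsto_sandwich[where f = "\<lambda>_. 0" and h = "\<lambda>x. exp (1/2) * G X * (x / X) powr (1/2) / x"])
    show "((\<lambda>x. exp (1/2) * G X * (x / X) powr (1/2) / x) \<longlongrightarrow> 0) at_top"
      using X0 by real_asymp
    show "\<forall>\<^sub>F x in at_top. G x / x \<le> exp (1/2) * G X * (x / X) powr (1/2) / x"
      using eventually_ge_at_top[of X]
      by eventually_elim (use X0 bound in \<open>auto intro!: divide_right_mono\<close>)
    show "\<forall>\<^sub>F x in at_top. 0 \<le> G x / x"
      using eventually_ge_at_top[of X] by eventually_elim (use X0 G0 in auto)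
  qed auto
  then have "((\<lambda>x. G x / x * (N x / M x)) \<longlongrightarrow> 0 * 4) at_top"
    by (intro tendsto_intros NM)
  moreover have "\<forall>\<^sub>F x in at_top. G x / x * (N x / M x) = f x / (x * M x)"
    using eventually_ge_at_top[of X]
  proof eventually_elim
    case (elim x)
    then have "N x \<noteq> 0" using X by force
    then show ?case by (simp add: G_def)
  qed
  ultimately show ?thesis
      using Lim_transform_eventually by fastforce
qed

text \<open>Morally \<open>h(lx) - h(x) = \<integral> x B(sx) ds\<close> over \<open>[1,l]\<close>, with integrand asymptotic to \<open>L(x)/s\<close>. Since
\<open>B\<close> is only known as a slope, the integral is replaced by Riemann sums over the \<open>n\<close> steps of ratio
\<open>l\<^bsup>1/n\<^esup>\<close>; the lower and upper sums tend to \<open>n(1 - l\<^bsup>-1/n\<^esup>)\<close> and \<open>n(l\<^bsup>1/n\<^esup> - 1)\<close>, and both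
of these tend to \<open>log l\<close>.\<close>

lemma Pi_of_density:
  fixes h B L :: "real \<Rightarrow> real"
  assumes upper: "\<And>a b. 0 < a \<Longrightarrow> a < b \<Longrightarrow> h b - h a \<le> (b - a) * B a"
    and lower: "\<And>a b. 0 < a \<Longrightarrow> a < b \<Longrightarrow> (b - a) * B b \<le> h b - h a"
    and L: "\<forall>\<^sub>F x in at_top. L x > 0"
    and slow: "\<And>l. l > 0 \<Longrightarrow> ((\<lambda>x. L (l * x) / L x) \<longlongrightarrow> 1) at_top"
    and dens: "((\<lambda>x. x * B x / L x) \<longlongrightarrow> 1) at_top" and l: "l > 0"
  shows "((\<lambda>x. (h (l * x) - h x) / L x) \<longlongrightarrow> ln l) at_top"
proof -
  have dens_at: "((\<lambda>x. c * x * B (c * x) / L x) \<longlongrightarrow> 1) at_top" if c: "c > 0" for c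
  proof -
    have "filterlim (\<lambda>x. c * x) at_top at_top" using c by real_asymp
    from filterlim_compose[OF dens this]
    have "((\<lambda>x. c * x * B (c * x) / L (c * x) * (L (c * x) / L x)) \<longlongrightarrow> 1 * 1) at_top"
      by (intro tendsto_intros slow c)
    then have "((\<lambda>x. c * x * B (c * x) / L (c * x) * (L (c * x) / L x)) \<longlongrightarrow> 1) at_top"
      by simp
    moreover have "\<forall>\<^sub>F x in at_top. L (c * x) > 0"
      using L by (rule eventually_compose_filterlim) (use c in real_asymp)
    then have "\<forall>\<^sub>F x in at_top.
        c * x * B (c * x) / L (c * x) * (L (c * x) / L x) = c * x * B (c * x) / L x"
      by eventually_elim simp
    ultimately show ?thesis
      using Lim_transform_eventually by fastforce
  qed
  have gt1: "((\<lambda>x. (h (l * x) - h x) / L x) \<longlongrightarrow> ln l) at_top" if l: "l > 1" for l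
  proof -
    define r where "r = (\<lambda>n::nat. l powr (1 / n))"
    have r1: "r n > 1" if "n > 0" for n using l that by (simp add: r_def)
    have rn: "r n ^ n = l" if "n > 0" for n
      using l that by (simp add: r_def powr_realpow[symmetric] powr_powr)
    have tel: "h (l * x) - h x = (\<Sum>k<n. h (r n ^ Suc k * x) - h (r n ^ k * x))" if "n > 0" for n x
      by (subst sum_lessThan_telescope) (simp add: rn that)
    have low: "((\<lambda>x. \<Sum>k<n. (1 - 1 / r n) * (r n ^ Suc k * x * B (r n ^ Suc k * x) / L x))
        \<longlongrightarrow> (\<Sum>k<n. (1 - 1 / r n) * 1)) at_top" if "n > 0" for n
      using r1[OF that] by (intro tendsto_sum tendsto_mult dens_at tendsto_const) auto
    have up: "((\<lambda>x. \<Sum>k<n. (r n - 1) * (r n ^ k * x * B (r n ^ k * x) / L x))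
        \<longlongrightarrow> (\<Sum>k<n. (r n - 1) * 1)) at_top" if "n > 0" for n
      using r1[OF that] by (intro tendsto_sum tendsto_mult dens_at tendsto_const) auto
    have bounds: "\<forall>\<^sub>F x in at_top.
        (\<Sum>k<n. (1 - 1 / r n) * (r n ^ Suc k * x * B (r n ^ Suc k * x) / L x)) \<le> (h (l * x) - h x) / L x \<and>
        (h (l * x) - h x) / L x \<le> (\<Sum>k<n. (r n - 1) * (r n ^ k * x * B (r n ^ k * x) / L x))"
      if n: "n > 0" for n
      using L eventually_gt_at_top[of 0]
    proof eventually_elim
      case (elim x)
      let ?r = "r n"
      have r: "?r > 1" by (rule r1[OF n])
      have less: "0 < ?r ^ k * x" "?r ^ k * x < ?r ^ Suc k * x" for k
        using r elim by auto
      have "(\<Sum>k<n. (1 - 1 / ?r) * (?r ^ Suc k * x * B (?r ^ Suc k * x) / L x))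
          = (\<Sum>k<n. (?r ^ Suc k * x - ?r ^ k * x) * B (?r ^ Suc k * x) / L x)"
      proof (rule sum.cong)
        fix k
        have "(1 - 1 / ?r) * ?r ^ Suc k * x = ?r ^ Suc k * x - ?r ^ k * x"
          using r by (simp add: left_diff_distrib)
        then show "(1 - 1 / ?r) * (?r ^ Suc k * x * B (?r ^ Suc k * x) / L x)
            = (?r ^ Suc k * x - ?r ^ k * x) * B (?r ^ Suc k * x) / L x"
          by (metis mult.assoc times_divide_eq_right)
      qed simp
      also have "\<dots> \<le> (\<Sum>k<n. (h (?r ^ Suc k * x) - h (?r ^ k * x)) / L x)"
        using elim less by (intro sum_mono divide_right_mono lower) auto
      also have "\<dots> = (h (l * x) - h x) / L x"
        by (simp add: tel[OF n] sum_divide_distrib)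
      finally have 1: "(\<Sum>k<n. (1 - 1 / ?r) * (?r ^ Suc k * x * B (?r ^ Suc k * x) / L x))
        \<le> (h (l * x) - h x) / L x" .
      have "(h (l * x) - h x) / L x = (\<Sum>k<n. (h (?r ^ Suc k * x) - h (?r ^ k * x)) / L x)"
        by (simp add: tel[OF n] sum_divide_distrib)
      also have "\<dots> \<le> (\<Sum>k<n. (?r ^ Suc k * x - ?r ^ k * x) * B (?r ^ k * x) / L x)"
        using elim less by (intro sum_mono divide_right_mono upper) auto
      also have "\<dots> = (\<Sum>k<n. (?r - 1) * (?r ^ k * x * B (?r ^ k * x) / L x))"
        by (simp add: algebra_simps)
      finally show ?case using 1 by simp
    qed
    show ?thesis
    proof (rule order_tendstoI)
      fix a assume a: "a < ln l"
      have "(\<lambda>n::nat. n * (1 - 1 / l powr (1 / n))) \<longlonglongrightarrow> ln l"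
        using l by real_asymp
      then have "\<forall>\<^sub>F n in sequentially. a < n * (1 - 1 / r n) \<and> n > 0"
        unfolding r_def using a by (intro eventually_conj order_tendstoD(1) eventually_gt_at_top)
      then obtain n where n: "a < n * (1 - 1 / r n)" "n > 0"
        using eventually_happens'[OF sequentially_bot] by blast
      then have "a < (\<Sum>k<n. (1 - 1 / r n) * 1)" by simp
      from order_tendstoD(1)[OF low[OF n(2)] this] bounds[OF n(2)]
      show "\<forall>\<^sub>F x in at_top. a < (h (l * x) - h x) / L x" by eventually_elim simp
    next
      fix b assume b: "ln l < b"
      have "(\<lambda>n::nat. n * (l powr (1 / n) - 1)) \<longlonglongrightarrow> ln l"
        using l by real_asymp
      then have "\<forall>\<^sub>F n in sequentially. n * (r n - 1) < b \<and> n > 0"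
        unfolding r_def using b by (intro eventually_conj order_tendstoD(2) eventually_gt_at_top)
      then obtain n where n: "n * (r n - 1) < b" "n > 0"
        using eventually_happens'[OF sequentially_bot] by blast
      then have "(\<Sum>k<n. (r n - 1) * 1) < b" by simp
      from order_tendstoD(2)[OF up[OF n(2)] this] bounds[OF n(2)]
      show "\<forall>\<^sub>F x in at_top. (h (l * x) - h x) / L x < b" by eventually_elim simp
    qed
  qed
  consider "l > 1" | "l = 1" | "l < 1" by linarith
  then show ?thesis
  proof cases
    case 1 then show ?thesis by (rule gt1)
  next
    case 2 then show ?thesis by simp
  next
    case 3
    then have "1 / l > 1" using l by simp
    have lx: "filterlim (\<lambda>x. l * x) at_top at_top" using l by real_asymp
    from filterlim_compose[OF gt1[OF \<open>1 / l > 1\<close>] lx]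
    have "((\<lambda>x. (h x - h (l * x)) / L (l * x)) \<longlongrightarrow> - ln l) at_top"
      using l by (simp add: ln_div)
    from tendsto_minus[OF tendsto_mult[OF this slow[OF l]]]
    have "((\<lambda>x. - ((h x - h (l * x)) / L (l * x) * (L (l * x) / L x))) \<longlongrightarrow> ln l) at_top"
      by simp
    moreover have "\<forall>\<^sub>F x in at_top. L (l * x) > 0"
      using L by (rule eventually_compose_filterlim) (rule lx)
    then have "\<forall>\<^sub>F x in at_top. - ((h x - h (l * x)) / L (l * x) * (L (l * x) / L x))
        = (h (l * x) - h x) / L x"
      by eventually_elim (simp add: minus_divide_left)
    ultimately show ?thesis
      using Lim_transform_eventually by fastforce
  qed
qed

section \<open>Measures on the half-line and their Stieltjes transforms\<close>

lemma inverse_power_increment: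
  fixes u v :: real
  assumes uv: "0 < u" "u < v"
  shows "(v - u) * (real n / v ^ (n + 1)) \<le> 1 / u ^ n - 1 / v ^ n"
    and "1 / u ^ n - 1 / v ^ n \<le> (v - u) * (real n / u ^ (n + 1))"
proof -
  have der: "((\<lambda>x::real. - (1 / x ^ n)) has_real_derivative real n / x ^ (n + 1)) (at x)"
    if "u \<le> x" "x \<le> v" for x
  proof -
    have "x > 0" using that uv by simp
    have "((\<lambda>x. inverse x ^ n) has_real_derivative
        real n * (- (inverse x ^ Suc (Suc 0)) * inverse x ^ (n - Suc 0))) (at x)"
      using DERIV_power[OF DERIV_inverse[of x], of n] \<open>x > 0\<close> by simp
    moreover have "real n * (- (inverse x ^ Suc (Suc 0)) * inverse x ^ (n - Suc 0))
        = - (real n / x ^ (n + 1))"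
      by (cases n) (simp_all add: field_simps)
    ultimately have "((\<lambda>x. - (inverse x ^ n)) has_real_derivative real n / x ^ (n + 1)) (at x)"
      using DERIV_minus by fastforce
    then show ?thesis by (simp only: inverse_eq_divide power_one_over)
  qed
  obtain z where z: "u < z" "z < v" "- (1 / v ^ n) - (- (1 / u ^ n)) = (v - u) * (real n / z ^ (n + 1))"
    using MVT2[OF uv(2), of "\<lambda>x. - (1 / x ^ n)" "\<lambda>x. real n / x ^ (n + 1)"] der by blast
  have "u ^ (n + 1) \<le> z ^ (n + 1)" "z ^ (n + 1) \<le> v ^ (n + 1)"
    by (rule power_mono, use z uv in linarith, use z uv in linarith)+
  moreover have "0 < u ^ (n + 1)" "0 < v ^ (n + 1)" "0 < z ^ (n + 1)"
    by (rule zero_less_power, use z uv in linarith)+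
  ultimately have "real n / v ^ (n + 1) \<le> real n / z ^ (n + 1)" "real n / z ^ (n + 1) \<le> real n / u ^ (n + 1)"
    by (intro divide_left_mono mult_pos_pos; linarith?; simp)+
  then show "(v - u) * (real n / v ^ (n + 1)) \<le> 1 / u ^ n - 1 / v ^ n"
      "1 / u ^ n - 1 / v ^ n \<le> (v - u) * (real n / u ^ (n + 1))"
    using z(3) mult_left_mono[of _ _ "v - u"] uv by fastforce+
qed

locale half_line_distribution = prob_space \<mu> for \<mu> :: "real measure" +
  assumes sets_eq: "sets \<mu> = sets (restrict_space borel {0..})"
    and nontrivial: "measure \<mu> {0<..} > 0"
begin

lemma space_eq: "space \<mu> = {0..}"
  using sets_eq_imp_space_eq[OF sets_eq] by (simp add: space_restrict_space)

lemma measurable_point [measurable]: "(\<lambda>t. t) \<in> borel_measurable \<mu>"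
  by (subst measurable_cong_sets[OF sets_eq refl]) (rule measurable_restrict_space1, simp)

lemma bounded_imp_integrable:
  fixes f :: "real \<Rightarrow> real"
  assumes "f \<in> borel_measurable \<mu>" "\<And>t. t \<ge> 0 \<Longrightarrow> \<bar>f t\<bar> \<le> C"
  shows "integrable \<mu> f"
  using assms by (intro integrable_const_bound[of f C] AE_I2) (auto simp: space_eq)

lemma integral_mono_half_line:
  fixes f :: "real \<Rightarrow> real"
  assumes "integrable \<mu> f" "integrable \<mu> f'" "\<And>t. t \<ge> 0 \<Longrightarrow> f t \<le> f' t"
  shows "integral\<^sup>L \<mu> f \<le> integral\<^sup>L \<mu> f'"
  using assms by (intro integral_mono) (auto simp: space_eq)

lemma integral_pos_half_line:
  fixes f :: "real \<Rightarrow> real"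
  assumes f: "integrable \<mu> f" and "\<And>t. t \<ge> 0 \<Longrightarrow> f t \<ge> 0" and pos: "\<And>t. t > 0 \<Longrightarrow> f t > 0"
  shows "integral\<^sup>L \<mu> f > 0"
proof -
  have nn: "AE t in \<mu>. f t \<ge> 0" using assms(2) by (intro AE_I2) (auto simp: space_eq)
  have "integral\<^sup>L \<mu> f \<noteq> 0"
  proof
    assume "integral\<^sup>L \<mu> f = 0"
    then have "AE t in \<mu>. f t = 0" using integral_nonneg_eq_0_iff_AE[OF f nn] by simp
    then have "AE t in \<mu>. t \<notin> {0<..}" by eventually_elim (use pos in force)
    moreover have "{t \<in> space \<mu>. \<not> t \<notin> {0<..}} = {0<..}" by (auto simp: space_eq)
    ultimately have "emeasure \<mu> {0<..} = 0"
      by (subst (asm) AE_iff_measurable[OF _ refl]) (auto simp: sets_eq sets_restrict_space)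
    then show False using nontrivial by (simp add: measure_def)
  qed
  moreover have "integral\<^sup>L \<mu> f \<ge> 0" using nn by (rule integral_nonneg_AE)
  ultimately show ?thesis by simp
qed

definition tail :: "real \<Rightarrow> real" where
  "tail x = measure \<mu> {x<..}"

text \<open>The integrand is \<open>t\<^sup>2/(t+y)\<^bsup>n+2\<^esup>\<close>, so that \<open>stieltjes 0\<close> is the derivative of \<open>parallel_mean\<close> and,
up to sign, \<open>(n+1)! \<cdot> stieltjes n\<close> is its derivative of order \<open>n + 1\<close>. The form chosen separates the factor \<open>(t/(t+y))\<^sup>2\<close>, which
stays fixed in Karamata's argument.\<close>

definition stieltjes :: "nat \<Rightarrow> real \<Rightarrow> real" where
  "stieltjes n y = (LINT t|\<mu>. (t / (t + y))\<^sup>2 / (t + y) ^ n)"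

text \<open>The mean of \<open>ty/(t+y)\<close>, the resistance of \<open>t\<close> and \<open>y\<close> connected in parallel. It truncates
\<open>t\<close> smoothly at height \<open>y\<close>.\<close>

definition parallel_mean :: "real \<Rightarrow> real" where
  "parallel_mean y = (LINT t|\<mu>. t * y / (t + y))"

lemma tail_sets: "x \<ge> 0 \<Longrightarrow> {x<..} \<in> sets \<mu>"
  by (auto simp: sets_eq sets_restrict_space image_iff intro!: bexI[of _ "{x<..}"])

lemma ratio_le_1: "t \<ge> 0 \<Longrightarrow> y > 0 \<Longrightarrow> \<bar>t / (t + y)\<bar> \<le> (1 :: real)"
  by simp

lemma integrable_stieltjes:
  assumes "y > 0"
  shows "integrable \<mu> (\<lambda>t. (t / (t + y))\<^sup>2 / (t + y) ^ n)"
proof (rule bounded_imp_integrable[where C = "1 / y ^ n"])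
  fix t :: real assume t: "t \<ge> 0"
  have "(t / (t + y))\<^sup>2 \<le> 1"
    using ratio_le_1[OF t assms] by (simp add: abs_square_le_1)
  moreover have "y ^ n \<le> (t + y) ^ n" using t assms by (intro power_mono) auto
  ultimately have "(t / (t + y))\<^sup>2 / (t + y) ^ n \<le> 1 / y ^ n"
    using t assms by (intro frac_le) auto
  then show "\<bar>(t / (t + y))\<^sup>2 / (t + y) ^ n\<bar> \<le> 1 / y ^ n"
    using t assms by simp
qed measurable

lemma integrable_parallel_mean:
  assumes "y > 0"
  shows "integrable \<mu> (\<lambda>t. t * y / (t + y))"
proof (rule bounded_imp_integrable[where C = y])
  fix t :: real assume t: "t \<ge> 0"
  show "\<bar>t * y / (t + y)\<bar> \<le> y"
    using t assms by (simp add: field_simps)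
qed measurable

lemma stieltjes_pos: "y > 0 \<Longrightarrow> stieltjes n y > 0"
  unfolding stieltjes_def by (rule integral_pos_half_line[OF integrable_stieltjes]) auto

lemma parallel_mean_pos: "y > 0 \<Longrightarrow> parallel_mean y > 0"
  unfolding parallel_mean_def by (rule integral_pos_half_line[OF integrable_parallel_mean]) auto

text \<open>The increment is the mean of \<open>(b-a) \<cdot> t/(t+a) \<cdot> t/(t+b)\<close>. This expresses concavity with slope
\<open>stieltjes 0\<close> in exactly the form that monotone density uses, without differentiating under the integral.\<close>

lemma parallel_mean_increment:
  assumes ab: "0 < a" "a < b"
  shows "(b - a) * stieltjes 0 b \<le> parallel_mean b - parallel_mean a"
    and "parallel_mean b - parallel_mean a \<le> (b - a) * stieltjes 0 a"
proof -
  have b: "0 < b" using ab by simp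
  have diff: "parallel_mean b - parallel_mean a = (LINT t|\<mu>. t * b / (t + b) - t * a / (t + a))"
    unfolding parallel_mean_def using ab b by (intro Bochner_Integration.integral_diff[symmetric] integrable_parallel_mean)
  have eq: "t * b / (t + b) - t * a / (t + a) = (b - a) * (t / (t + b) * (t / (t + a)))"
    if "t \<ge> 0" for t
    using that ab by (simp add: divide_simps) algebra
  have m: "t / (t + b) \<le> t / (t + a)" if "t \<ge> 0" for t
    using that ab by (intro divide_left_mono) auto
  have int: "integrable \<mu> (\<lambda>t. t * b / (t + b) - t * a / (t + a))"
    by (intro Bochner_Integration.integrable_diff integrable_parallel_mean ab b)
  show "(b - a) * stieltjes 0 b \<le> parallel_mean b - parallel_mean a"
    unfolding diff stieltjes_def integral_mult_right_zero[symmetric]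
  proof (rule integral_mono_half_line[OF _ int])
    fix t :: real assume t: "t \<ge> 0"
    have "t / (t + b) * (t / (t + b)) \<le> t / (t + b) * (t / (t + a))"
      by (rule mult_left_mono[OF m[OF t]]) (use t b in simp)
    then have "(b - a) * (t / (t + b) * (t / (t + b))) \<le> (b - a) * (t / (t + b) * (t / (t + a)))"
      by (rule mult_left_mono) (use ab in simp)
    then show "(b - a) * ((t / (t + b))\<^sup>2 / (t + b) ^ 0) \<le> t * b / (t + b) - t * a / (t + a)"
      unfolding eq[OF t] by (simp add: power2_eq_square)
  qed (use integrable_stieltjes[OF b, of 0] in auto)
  show "parallel_mean b - parallel_mean a \<le> (b - a) * stieltjes 0 a"
    unfolding diff stieltjes_def integral_mult_right_zero[symmetric]
  proof (rule integral_mono_half_line[OF int])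
    fix t :: real assume t: "t \<ge> 0"
    have "t / (t + b) * (t / (t + a)) \<le> t / (t + a) * (t / (t + a))"
      by (rule mult_right_mono[OF m[OF t]]) (use t ab in simp)
    then have "(b - a) * (t / (t + b) * (t / (t + a))) \<le> (b - a) * (t / (t + a) * (t / (t + a)))"
      by (rule mult_left_mono) (use ab in simp)
    then show "t * b / (t + b) - t * a / (t + a) \<le> (b - a) * ((t / (t + a))\<^sup>2 / (t + a) ^ 0)"
      unfolding eq[OF t] by (simp add: power2_eq_square)
  qed (use integrable_stieltjes[OF ab(1), of 0] in auto)
qed

lemma stieltjes_increment:
  assumes ab: "0 < a" "a < b"
  shows "(b - a) * (real (n + 2) * stieltjes (Suc n) b) \<le> stieltjes n a - stieltjes n b"
    and "stieltjes n a - stieltjes n b \<le> (b - a) * (real (n + 2) * stieltjes (Suc n) a)"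
proof -
  have b: "0 < b" using ab by simp
  have merge_powers: "(t / (t + y))\<^sup>2 / (t + y) ^ k = t\<^sup>2 * (1 / (t + y) ^ (k + 2))" for t y :: real and k
    by (simp add: power_divide power_add power2_eq_square mult.commute)
  have diff: "stieltjes n a - stieltjes n b =
      (LINT t|\<mu>. (t / (t + a))\<^sup>2 / (t + a) ^ n - (t / (t + b))\<^sup>2 / (t + b) ^ n)"
    unfolding stieltjes_def using ab b
    by (intro Bochner_Integration.integral_diff[symmetric] integrable_stieltjes)
  have int: "integrable \<mu> (\<lambda>t. (t / (t + a))\<^sup>2 / (t + a) ^ n - (t / (t + b))\<^sup>2 / (t + b) ^ n)"
    by (intro Bochner_Integration.integrable_diff integrable_stieltjes ab b)
  have intc: "integrable \<mu> (\<lambda>t. (b - a) * (real (n + 2) * ((t / (t + y))\<^sup>2 / (t + y) ^ Suc n)))"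
    if "y > 0" for y
    using integrable_stieltjes[OF that, of "Suc n"] by (intro integrable_mult_right)
  show "(b - a) * (real (n + 2) * stieltjes (Suc n) b) \<le> stieltjes n a - stieltjes n b"
    unfolding diff unfolding stieltjes_def integral_mult_right_zero[symmetric]
  proof (rule integral_mono_half_line[OF intc[OF b] int])
    fix t :: real assume t: "t \<ge> 0"
    have "t\<^sup>2 * ((t + b - (t + a)) * (real (n + 2) / (t + b) ^ (n + 2 + 1)))
        \<le> t\<^sup>2 * (1 / (t + a) ^ (n + 2) - 1 / (t + b) ^ (n + 2))"
      by (rule mult_left_mono[OF inverse_power_increment(1)]) (use t ab in auto)
    then show "(b - a) * (real (n + 2) * ((t / (t + b))\<^sup>2 / (t + b) ^ Suc n))
        \<le> (t / (t + a))\<^sup>2 / (t + a) ^ n - (t / (t + b))\<^sup>2 / (t + b) ^ n"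
      unfolding merge_powers by (simp add: algebra_simps)
  qed
  show "stieltjes n a - stieltjes n b \<le> (b - a) * (real (n + 2) * stieltjes (Suc n) a)"
    unfolding diff unfolding stieltjes_def integral_mult_right_zero[symmetric]
  proof (rule integral_mono_half_line[OF int intc[OF ab(1)]])
    fix t :: real assume t: "t \<ge> 0"
    have "t\<^sup>2 * (1 / (t + a) ^ (n + 2) - 1 / (t + b) ^ (n + 2))
        \<le> t\<^sup>2 * ((t + b - (t + a)) * (real (n + 2) / (t + a) ^ (n + 2 + 1)))"
      by (rule mult_left_mono[OF inverse_power_increment(2)]) (use t ab in auto)
    then show "(t / (t + a))\<^sup>2 / (t + a) ^ n - (t / (t + b))\<^sup>2 / (t + b) ^ n
        \<le> (b - a) * (real (n + 2) * ((t / (t + a))\<^sup>2 / (t + a) ^ Suc n))"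
      unfolding merge_powers by (simp add: algebra_simps)
  qed
qed

text \<open>Since \<open>(n+2) stieltjes (n+1)\<close> is minus the derivative of the decreasing convex function
\<open>stieltjes n\<close>, each step is one application of monotone density, with \<open>K(y) = L(y)/y\<^bsup>n+1\<^esup>\<close>.\<close>

lemma stieltjes_asymptotics:
  fixes L :: "real \<Rightarrow> real"
  assumes L: "\<forall>\<^sub>F x in at_top. L x > 0"
    and slow: "\<And>l. l > 0 \<Longrightarrow> ((\<lambda>x. L (l * x) / L x) \<longlongrightarrow> 1) at_top"
    and base: "((\<lambda>y. y * stieltjes 0 y / L y) \<longlongrightarrow> 1) at_top"
  shows "((\<lambda>y. y ^ Suc n * stieltjes n y / L y) \<longlongrightarrow> 1 / Suc n) at_top"
proof (induction n)
  case 0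
  then show ?case using base by simp
next
  case (Suc n)
  define \<phi> where "\<phi> = (\<lambda>l::real. (1 - 1 / l ^ Suc n) / Suc n)"
  have "((\<lambda>x. x * (real (n + 2) * stieltjes (Suc n) x) / (L x / x ^ Suc n)) \<longlongrightarrow> 1) at_top"
  proof (rule monotone_density[where A = "stieltjes n" and \<phi> = \<phi> and q = "\<lambda>l x. l * x"])
    show "\<forall>\<^sub>F x in at_top. 0 < L x / x ^ Suc n"
      using L eventually_gt_at_top[of 0] by eventually_elim simp
    show "((\<lambda>x. l * x / x) \<longlongrightarrow> l) at_top" for l :: real
      by (rule tendsto_eventually) (use eventually_gt_at_top[of 0] in eventually_elim, simp)
    show "((\<lambda>x. (stieltjes n x - stieltjes n (l * x)) / (L x / x ^ Suc n)) \<longlongrightarrow> \<phi> l) at_top"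
      if l: "l > 0" for l
    proof -
      have lx: "filterlim (\<lambda>x. l * x) at_top at_top" using l by real_asymp
      have "((\<lambda>x. x ^ Suc n * stieltjes n x / L x
            - (l * x) ^ Suc n * stieltjes n (l * x) / L (l * x) * (L (l * x) / L x) / l ^ Suc n)
          \<longlongrightarrow> 1 / Suc n - 1 / Suc n * 1 / l ^ Suc n) at_top"
        using l by (intro tendsto_diff tendsto_mult tendsto_divide tendsto_const slow l Suc
            filterlim_compose[OF Suc lx]) auto
      moreover have "1 / Suc n - 1 / Suc n * 1 / l ^ Suc n = \<phi> l"
        by (simp add: \<phi>_def diff_divide_distrib mult.commute)
      moreover have "\<forall>\<^sub>F x in at_top. L (l * x) > 0"
        using L by (rule eventually_compose_filterlim) (rule lx)
      then have "\<forall>\<^sub>F x in at_top. x ^ Suc n * stieltjes n x / L x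
            - (l * x) ^ Suc n * stieltjes n (l * x) / L (l * x) * (L (l * x) / L x) / l ^ Suc n
          = (stieltjes n x - stieltjes n (l * x)) / (L x / x ^ Suc n)"
        using L eventually_gt_at_top[of 0]
      proof eventually_elim
        case (elim x)
        then show ?case using l
          by (simp add: power_mult_distrib diff_divide_distrib right_diff_distrib mult_ac del: power_Suc)
      qed
      ultimately show ?thesis using Lim_transform_eventually by fastforce
    qed
    show "(\<phi> has_real_derivative 1) (at 1)"
      unfolding \<phi>_def by (auto intro!: derivative_eq_intros)
  qed (use stieltjes_increment[of _ _ n] eventually_gt_at_top in \<open>auto simp: \<phi>_def\<close>)
  then have "((\<lambda>x. x * (real (n + 2) * stieltjes (Suc n) x) / (L x / x ^ Suc n) / real (n + 2)) \<longlongrightarrow> 1 / real (n + 2)) at_top"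
    by (intro tendsto_intros) auto
  then show ?case by (simp add: mult_ac)
qed

end

section \<open>The Tauberian direction: from the Stieltjes transform to the tail\<close>

text \<open>Continuous and piecewise linear, equal to \<open>1\<close> up to \<open>a\<close> and to \<open>0\<close> from \<open>b\<close> on.\<close>

definition ramp :: "real \<Rightarrow> real \<Rightarrow> real \<Rightarrow> real" where
  "ramp a b u = max 0 (min 1 ((b - u) / (b - a)))"

text \<open>The density \<open>1/(1-u)\<^sup>2\<close>, made bounded near its pole; any cap that takes effect strictly to the right
of \<open>u = 1/2\<close>, where the tail is cut off, would do.\<close>

definition capped_weight :: "real \<Rightarrow> real" where
  "capped_weight u = 1 / (max (1 - u) (1 / 4))\<^sup>2"

lemma continuous_ramp_capped_weight: "a < b \<Longrightarrow> continuous_on S (\<lambda>u. ramp a b u * capped_weight u)"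
  unfolding ramp_def capped_weight_def by (intro continuous_intros) auto

lemma ramp_range: "0 \<le> ramp a b u" "ramp a b u \<le> 1"
  by (auto simp: ramp_def)

lemma ramp_eq_1: "a < b \<Longrightarrow> u \<le> a \<Longrightarrow> ramp a b u = 1"
  by (auto simp: ramp_def)

lemma ramp_eq_0: "a < b \<Longrightarrow> b \<le> u \<Longrightarrow> ramp a b u = 0"
  by (auto simp: ramp_def divide_nonpos_pos)

lemma capped_weight_pos: "capped_weight u > 0"
  by (auto simp: capped_weight_def)

lemma has_integral_capped_weight:
  assumes "0 \<le> a" "a \<le> 3 / 4"
  shows "(capped_weight has_integral (1 / (1 - a) - 1)) {0..a}"
proof -
  have "((\<lambda>u. 1 / (1 - u)\<^sup>2) has_integral (1 / (1 - a) - 1 / (1 - 0))) {0..a}"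
    using assms
    by (intro fundamental_theorem_of_calculus)
      (auto intro!: derivative_eq_intros simp: has_real_derivative_iff_has_vector_derivative[symmetric] power2_eq_square field_simps)
  then have "((\<lambda>u. 1 / (1 - u)\<^sup>2) has_integral (1 / (1 - a) - 1)) {0..a}" by simp
  then show ?thesis
    by (rule has_integral_eq[rotated]) (use assms in \<open>auto simp: capped_weight_def max_def\<close>)
qed

text \<open>As \<open>a\<close> and \<open>b\<close> approach \<open>1/2\<close>, both bounds tend to \<open>1\<close>, the integral of \<open>1/(1-u)\<^sup>2\<close> over
\<open>[0,1/2]\<close>.\<close>

lemma integral_ramp_capped_weight:
  assumes ab: "0 \<le> a" "a < b" "b \<le> 3 / 4"
  shows "1 / (1 - a) - 1 \<le> integral {0..1} (\<lambda>u. ramp a b u * capped_weight u)"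
    and "integral {0..1} (\<lambda>u. ramp a b u * capped_weight u) \<le> 1 / (1 - b) - 1"
proof -
  let ?f = "\<lambda>u. ramp a b u * capped_weight u"
  have int: "?f integrable_on {0..c}" for c
    using ab by (intro integrable_continuous_interval continuous_ramp_capped_weight)
  have nn: "?f u \<ge> 0" for u using ramp_range(1)[of a b u] capped_weight_pos[of u] by simp
  have "1 / (1 - a) - 1 = integral {0..a} capped_weight"
    using has_integral_capped_weight[of a] ab by (simp add: integral_unique)
  also have "\<dots> = integral {0..a} ?f"
    using ab by (intro integral_cong) (simp add: ramp_eq_1)
  also have "\<dots> \<le> integral {0..1} ?f"
    using ab nn int by (intro integral_subset_le) auto
  finally show "1 / (1 - a) - 1 \<le> integral {0..1} ?f" .
  have "integral {0..1} ?f = integral {0..b} ?f + integral {b..1} ?f"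
    using ab int by (intro Henstock_Kurzweil_Integration.integral_combine[symmetric]) auto
  also have "integral {b..1} ?f = integral {b..1} (\<lambda>_. 0)"
    using ab by (intro integral_cong) (simp add: ramp_eq_0)
  also have "integral {0..b} ?f \<le> integral {0..b} capped_weight"
  proof (rule integral_le[OF int])
    show "capped_weight integrable_on {0..b}" using has_integral_capped_weight[of b] ab by auto
    show "?f u \<le> capped_weight u" for u
      using ramp_range[of a b u] capped_weight_pos[of u] by (simp add: mult_left_le_one_le)
  qed
  also have "integral {0..b} capped_weight = 1 / (1 - b) - 1"
    using has_integral_capped_weight[of b] ab by (simp add: integral_unique)
  finally show "integral {0..1} ?f \<le> 1 / (1 - b) - 1" by simp
qed

context half_line_distribution begin

text \<open>With \<open>u = y/(t+y)\<close>, hence \<open>1 - u = t/(t+y)\<close>, this is the integral of \<open>(1-u)\<^sup>2 \<phi>(u)\<close>. For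
\<open>\<phi>(u) = u\<^sup>n\<close> it is \<open>y\<^sup>n stieltjes n y\<close>, and for \<open>\<phi>\<close> equal to \<open>1/(1-u)\<^sup>2\<close> on \<open>u < 1/2\<close> and to
\<open>0\<close> elsewhere it is the tail at \<open>y\<close>.\<close>

definition functional :: "(real \<Rightarrow> real) \<Rightarrow> real \<Rightarrow> real" where
  "functional \<phi> y = (LINT t|\<mu>. (t / (t + y))\<^sup>2 * \<phi> (y / (t + y)))"

lemma unit_ratio:
  assumes "y > 0" "t \<ge> (0::real)"
  shows "y / (t + y) \<in> {0..1}" "1 - y / (t + y) = t / (t + y)"
  using assms by (auto simp: field_simps)

lemma integrable_functional:
  assumes \<phi>: "continuous_on UNIV \<phi>" and y: "y > 0"
  shows "integrable \<mu> (\<lambda>t. (t / (t + y))\<^sup>2 * \<phi> (y / (t + y)))"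
proof -
  have "compact (\<phi> ` {0..1})"
    using \<phi> by (intro compact_continuous_image) (auto intro: continuous_on_subset)
  then obtain C where C: "\<And>u. u \<in> {0..1} \<Longrightarrow> \<bar>\<phi> u\<bar> \<le> C"
    using compact_imp_bounded by (fastforce simp: bounded_iff)
  have [measurable]: "\<phi> \<in> borel_measurable borel"
    using \<phi> by (rule borel_measurable_continuous_onI)
  show ?thesis
  proof (rule bounded_imp_integrable[where C = C])
    fix t :: real assume t: "t \<ge> 0"
    have "\<bar>(t / (t + y))\<^sup>2\<bar> \<le> 1"
      using ratio_le_1[OF t y] by (simp add: abs_square_le_1)
    then have "\<bar>(t / (t + y))\<^sup>2\<bar> * \<bar>\<phi> (y / (t + y))\<bar> \<le> 1 * C"
      using C[OF unit_ratio(1)[OF y t]] by (intro mult_mono) auto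
    then show "\<bar>(t / (t + y))\<^sup>2 * \<phi> (y / (t + y))\<bar> \<le> C" by (simp add: abs_mult)
  qed measurable
qed

lemma functional_mono:
  assumes "continuous_on UNIV \<phi>" "continuous_on UNIV \<psi>" "y > 0" "\<And>u. u \<in> {0..1} \<Longrightarrow> \<phi> u \<le> \<psi> u"
  shows "functional \<phi> y \<le> functional \<psi> y"
  unfolding functional_def using assms unit_ratio
  by (intro integral_mono_half_line integrable_functional mult_left_mono) auto

lemma functional_power:
  assumes y: "y > 0"
  shows "functional (\<lambda>u. u ^ n) y = y ^ n * stieltjes n y"
proof -
  have "functional (\<lambda>u. u ^ n) y = (LINT t|\<mu>. y ^ n * ((t / (t + y))\<^sup>2 / (t + y) ^ n))"
    unfolding functional_def by (simp add: power_divide[of y] mult_ac)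
  also have "\<dots> = y ^ n * stieltjes n y" unfolding stieltjes_def by (rule integral_mult_right_zero)
  finally show ?thesis .
qed

lemma functional_linear:
  assumes "continuous_on UNIV \<phi>" "continuous_on UNIV \<psi>" "y > 0"
  shows "functional (\<lambda>u. \<phi> u + c * \<psi> u) y = functional \<phi> y + c * functional \<psi> y"
proof -
  have "functional (\<lambda>u. \<phi> u + c * \<psi> u) y =
      (LINT t|\<mu>. (t / (t + y))\<^sup>2 * \<phi> (y / (t + y)) + c * ((t / (t + y))\<^sup>2 * \<psi> (y / (t + y))))"
    unfolding functional_def by (simp add: algebra_simps)
  also have "\<dots> = functional \<phi> y + c * functional \<psi> y"
    unfolding functional_def
    using integrable_functional[OF assms(1,3)] integrable_functional[OF assms(2,3)] by simp
  finally show ?thesis .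
qed

lemma functional_polynomial:
  assumes y: "y > 0"
  shows "functional (\<lambda>u. \<Sum>i\<le>n. a i * u ^ i) y = (\<Sum>i\<le>n. a i * (y ^ i * stieltjes i y))"
proof -
  have "functional (\<lambda>u. \<Sum>i\<le>n. a i * u ^ i) y
      = (LINT t|\<mu>. (\<Sum>i\<le>n. a i * ((t / (t + y))\<^sup>2 * (y / (t + y)) ^ i)))"
    unfolding functional_def by (simp add: sum_distrib_left mult_ac)
  also have "\<dots> = (\<Sum>i\<le>n. LINT t|\<mu>. a i * ((t / (t + y))\<^sup>2 * (y / (t + y)) ^ i))"
    using y by (intro Bochner_Integration.integral_sum integrable_mult_right
        integrable_functional[of "\<lambda>u. u ^ _"] continuous_intros)
  also have "\<dots> = (\<Sum>i\<le>n. a i * functional (\<lambda>u. u ^ i) y)"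
    unfolding functional_def by simp
  finally show ?thesis using y by (simp add: functional_power)
qed

text \<open>For powers of \<open>u\<close> the limit is \<open>1/(n+1)\<close>, the integral of \<open>u\<^sup>n\<close> over \<open>[0,1]\<close>. A uniform polynomial approximation
of \<open>\<phi>\<close> with error \<open>d\<close> changes the functional by at most \<open>d\<close> times its value at \<open>1\<close>, which stays bounded after scaling.\<close>

lemma functional_tendsto_integral:
  fixes L \<phi> :: "real \<Rightarrow> real"
  assumes L: "\<forall>\<^sub>F x in at_top. L x > 0"
    and mom: "\<And>n. ((\<lambda>y. y ^ Suc n * stieltjes n y / L y) \<longlongrightarrow> 1 / Suc n) at_top"
    and \<phi>: "continuous_on UNIV \<phi>"
  shows "((\<lambda>y. y / L y * functional \<phi> y) \<longlongrightarrow> integral {0..1} \<phi>) at_top"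
proof (rule tendstoI)
  fix e :: real assume "e > 0"
  define d where "d = e / 4"
  have d: "d > 0" "e = 4 * d" using \<open>e > 0\<close> by (auto simp: d_def)
  have \<phi>01: "continuous_on {0..1} \<phi>" using \<phi> by (rule continuous_on_subset) simp
  obtain p where "real_polynomial_function p" and p: "\<And>u. u \<in> {0..1} \<Longrightarrow> \<bar>\<phi> u - p u\<bar> < d"
    using Stone_Weierstrass_real_polynomial_function[OF _ \<phi>01 d(1)] by auto
  then obtain a n where pa: "p = (\<lambda>u. \<Sum>i\<le>n. a i * u ^ i)"
    by (auto simp: real_polynomial_function_iff_sum)
  have pc: "continuous_on S p" for S unfolding pa by (intro continuous_intros)
  have int_p: "integral {0..1} p = (\<Sum>i\<le>n. a i / Suc i)"
  proof -
    have "((\<lambda>u. u ^ i) has_integral (1 / Suc i)) {0..1::real}" for i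
    proof -
      have "((\<lambda>u. u ^ i) has_integral (1 ^ Suc i / Suc i - 0 ^ Suc i / Suc i)) {0..1::real}"
        by (intro fundamental_theorem_of_calculus)
          (auto intro!: DERIV_cong[OF DERIV_cdivide[OF DERIV_pow]]
            simp: has_real_derivative_iff_has_vector_derivative[symmetric] simp del: of_nat_Suc power_Suc)
      then show ?thesis by simp
    qed
    then have "(p has_integral (\<Sum>i\<le>n. a i * (1 / Suc i))) {0..1}"
      unfolding pa by (intro has_integral_sum has_integral_mult_right) auto
    then show ?thesis by (simp add: integral_unique)
  qed
  have near: "\<bar>integral {0..1} p - integral {0..1} \<phi>\<bar> \<le> d"
  proof -
    have "integral {0..1} p - integral {0..1} \<phi> = integral {0..1} (\<lambda>u. p u - \<phi> u)"
      using \<phi>01 pc by (intro integral_diff[symmetric] integrable_continuous_interval)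
    also have "norm \<dots> \<le> d * (1 - 0)"
      using p by (intro integral_bound continuous_intros pc \<phi>01) (auto simp: abs_minus_commute intro: less_imp_le)
    finally show ?thesis by simp
  qed
  have lim_p: "((\<lambda>y. y / L y * functional p y) \<longlongrightarrow> integral {0..1} p) at_top"
  proof -
    have "((\<lambda>y. \<Sum>i\<le>n. a i * (y ^ Suc i * stieltjes i y / L y)) \<longlongrightarrow> (\<Sum>i\<le>n. a i * (1 / Suc i))) at_top"
      by (intro tendsto_intros mom)
    moreover have "\<forall>\<^sub>F y in at_top.
        (\<Sum>i\<le>n. a i * (y ^ Suc i * stieltjes i y / L y)) = y / L y * functional p y"
      using eventually_gt_at_top[of 0]
      by eventually_elim (simp add: pa functional_polynomial sum_distrib_left mult_ac)
    ultimately show ?thesis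
      unfolding int_p using Lim_transform_eventually by fastforce
  qed
  have lim_1: "((\<lambda>y. y * stieltjes 0 y / L y) \<longlongrightarrow> 1) at_top" using mom[of 0] by simp
  have "\<forall>\<^sub>F y in at_top. y * stieltjes 0 y / L y < 2" using lim_1 by (rule order_tendstoD) simp
  moreover have "\<forall>\<^sub>F y in at_top. \<bar>y / L y * functional p y - integral {0..1} p\<bar> < d"
    using tendstoD[OF lim_p d(1)] by (simp add: dist_real_def)
  ultimately show "\<forall>\<^sub>F y in at_top. dist (y / L y * functional \<phi> y) (integral {0..1} \<phi>) < e"
    using L eventually_gt_at_top[of 0]
  proof eventually_elim
    case (elim y)
    have one: "functional (\<lambda>_. 1) y = stieltjes 0 y" using functional_power[of y 0] elim by simp
    have up: "functional \<phi> y \<le> functional p y + d * stieltjes 0 y"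
      using functional_mono[of \<phi> "\<lambda>u. p u + d * 1" y] functional_linear[of p "\<lambda>_. 1" y d] one pc \<phi> elim p
      by (force intro!: continuous_intros simp: abs_less_iff)
    have low: "functional p y + (- d) * stieltjes 0 y \<le> functional \<phi> y"
      using functional_mono[of "\<lambda>u. p u + (- d) * 1" \<phi> y] functional_linear[of p "\<lambda>_. 1" y "- d"] one pc \<phi> elim p
      by (force intro!: continuous_intros simp: abs_less_iff)
    have "\<bar>functional \<phi> y - functional p y\<bar> \<le> d * stieltjes 0 y" using up low by linarith
    then have "y / L y * \<bar>functional \<phi> y - functional p y\<bar> \<le> y / L y * (d * stieltjes 0 y)"
      using elim by (intro mult_left_mono) auto
    also have "\<dots> = d * (y * stieltjes 0 y / L y)" by simp
    also have "\<dots> \<le> d * 2" using elim d by (intro mult_left_mono) auto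
    finally have bound: "y / L y * \<bar>functional \<phi> y - functional p y\<bar> \<le> d * 2" .
    have "y / L y * \<bar>functional \<phi> y - functional p y\<bar>
        = \<bar>y / L y * functional \<phi> y - y / L y * functional p y\<bar>"
      unfolding right_diff_distrib[symmetric] abs_mult using elim by simp
    with bound have "\<bar>y / L y * functional \<phi> y - y / L y * functional p y\<bar> \<le> d * 2" by linarith
    then show ?case using elim(2) near d unfolding dist_real_def by linarith
  qed
qed

text \<open>The event \<open>t > y\<close> is \<open>u < 1/2\<close>, and its indicator lies between the ramps that end and that begin at
\<open>1/2\<close>, each times \<open>(1-u)\<^sup>2\<close> and the capped weight, a product that is \<open>1\<close> up to \<open>u = 3/4\<close> and never
negative. The limits of the two bounds are as close to \<open>1\<close> as desired.\<close>

lemma tail_of_stieltjes: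
  fixes L :: "real \<Rightarrow> real"
  assumes L: "\<forall>\<^sub>F x in at_top. L x > 0"
    and slow: "\<And>l. l > 0 \<Longrightarrow> ((\<lambda>x. L (l * x) / L x) \<longlongrightarrow> 1) at_top"
    and base: "((\<lambda>y. y * stieltjes 0 y / L y) \<longlongrightarrow> 1) at_top"
  shows "((\<lambda>y. y * tail y / L y) \<longlongrightarrow> 1) at_top"
proof -
  have lim: "((\<lambda>y. y / L y * functional (\<lambda>u. ramp a b u * capped_weight u) y)
      \<longlongrightarrow> integral {0..1} (\<lambda>u. ramp a b u * capped_weight u)) at_top" if "a < b" for a b
    by (intro functional_tendsto_integral L stieltjes_asymptotics slow base continuous_ramp_capped_weight that)
  have tail_eq: "tail y = (LINT t|\<mu>. indicator {y<..} t)" if "y \<ge> 0" for y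
    using tail_sets[OF that] by (simp add: tail_def)
  have int_tail: "integrable \<mu> (indicator {y<..} :: real \<Rightarrow> real)" if "y \<ge> 0" for y
    using tail_sets[OF that] by (simp add: integrable_indicator_iff emeasure_finite less_top[symmetric])
  have half: "t > y \<longleftrightarrow> y / (t + y) < 1 / 2" if "y > 0" "t \<ge> 0" for t y :: real
    using that by (simp add: field_simps)
  have low: "functional (\<lambda>u. ramp a (1/2) u * capped_weight u) y \<le> tail y" if y: "y > 0" and a: "a < 1 / 2" for a y
    unfolding functional_def tail_eq[OF less_imp_le[OF y]]
  proof (rule integral_mono_half_line[OF integrable_functional[OF continuous_ramp_capped_weight[OF a] y] int_tail])
    fix t :: real assume t: "t \<ge> 0"
    define u where "u = y / (t + y)"
    have ur: "t / (t + y) = 1 - u" using unit_ratio(2)[OF y t] by (simp add: u_def)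
    show "(t / (t + y))\<^sup>2 * (ramp a (1 / 2) (y / (t + y)) * capped_weight (y / (t + y))) \<le> indicator {y<..} t"
    proof (cases "t > y")
      case True
      then have "u < 1 / 2" using half[OF y t] by (simp add: u_def)
      then have "(1 - u)\<^sup>2 * capped_weight u = 1" by (simp add: capped_weight_def max_def)
      then have "(1 - u)\<^sup>2 * (ramp a (1 / 2) u * capped_weight u) = ramp a (1 / 2) u"
        by (metis mult.left_commute mult.right_neutral)
      then have "(1 - u)\<^sup>2 * (ramp a (1 / 2) u * capped_weight u) \<le> 1"
        using ramp_range(2)[of a "1/2" u] by linarith
      then show ?thesis using True unfolding u_def[symmetric] ur by simp
    next
      case False
      then have "u \<ge> 1 / 2" using half[OF y t] by (simp add: u_def)
      then show ?thesis using False a by (simp add: ramp_eq_0 flip: u_def)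
    qed
  qed (use y in auto)
  have up: "tail y \<le> functional (\<lambda>u. ramp (1/2) b u * capped_weight u) y" if y: "y > 0" and b: "1 / 2 < b" for b y
    unfolding functional_def tail_eq[OF less_imp_le[OF y]]
  proof (rule integral_mono_half_line[OF int_tail integrable_functional[OF continuous_ramp_capped_weight[OF b] y]])
    fix t :: real assume t: "t \<ge> 0"
    define u where "u = y / (t + y)"
    have ur: "t / (t + y) = 1 - u" using unit_ratio(2)[OF y t] by (simp add: u_def)
    show "indicator {y<..} t \<le> (t / (t + y))\<^sup>2 * (ramp (1 / 2) b (y / (t + y)) * capped_weight (y / (t + y)))"
    proof (cases "t > y")
      case True
      then have "u < 1 / 2" using half[OF y t] by (simp add: u_def)
      then have "(1 - u)\<^sup>2 * capped_weight u = 1" "ramp (1 / 2) b u = 1"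
        using b by (simp_all add: capped_weight_def max_def ramp_eq_1)
      then show ?thesis by (simp add: ur flip: u_def)
    next
      case False
      then show ?thesis using ramp_range(1)[of "1/2" b u] capped_weight_pos[of u] by (simp flip: u_def)
    qed
  qed (use y in auto)
  have cont: "((\<lambda>c. 1 / (1 - c) - 1) \<longlongrightarrow> 1) (at (1/2 :: real))"
  proof -
    have "((\<lambda>c. 1 / (1 - c) - 1) \<longlongrightarrow> 1 / (1 - 1 / 2) - 1) (at (1/2 :: real))"
      by (intro tendsto_intros) auto
    then show ?thesis by simp
  qed
  show ?thesis
  proof (rule order_tendstoI)
    fix c :: real assume c: "c < 1"
    have "\<forall>\<^sub>F a in at_left (1/2). c < 1 / (1 - a) - 1 \<and> 0 < a \<and> a < 1 / 2"
      using cont c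
      by (intro eventually_conj order_tendstoD(1)[of "\<lambda>a. 1 / (1 - a) - 1" 1])
        (auto simp: eventually_at_left_field intro: filterlim_mono at_le exI[of _ 0])
    then obtain a where a: "c < 1 / (1 - a) - 1" "0 < a" "a < 1 / 2"
      using eventually_happens'[OF trivial_limit_at_left_real] by blast
    have "c < integral {0..1} (\<lambda>u. ramp a (1/2) u * capped_weight u)"
      using integral_ramp_capped_weight(1)[of a "1/2"] a by simp
    from order_tendstoD(1)[OF lim[OF a(3)] this]
    show "\<forall>\<^sub>F y in at_top. c < y * tail y / L y"
      using L eventually_gt_at_top[of 0]
    proof eventually_elim
      case (elim y)
      have "y / L y * functional (\<lambda>u. ramp a (1/2) u * capped_weight u) y \<le> y / L y * tail y"
        using elim a by (intro mult_left_mono low) auto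
      then show ?case using elim by simp
    qed
  next
    fix c :: real assume c: "1 < c"
    have "\<forall>\<^sub>F b in at_right (1/2). 1 / (1 - b) - 1 < c \<and> 1 / 2 < b \<and> b < 3 / 4"
      using cont c
      by (intro eventually_conj order_tendstoD(2)[of "\<lambda>b. 1 / (1 - b) - 1" 1])
        (auto simp: eventually_at_right_field intro: filterlim_mono at_le exI[of _ "3/4"])
    then obtain b where b: "1 / (1 - b) - 1 < c" "1 / 2 < b" "b < 3 / 4"
      using eventually_happens'[OF trivial_limit_at_right_real] by blast
    have "integral {0..1} (\<lambda>u. ramp (1/2) b u * capped_weight u) < c"
      using integral_ramp_capped_weight(2)[of "1/2" b] b by simp
    from order_tendstoD(2)[OF lim[OF b(2)] this]
    show "\<forall>\<^sub>F y in at_top. y * tail y / L y < c"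
      using L eventually_gt_at_top[of 0]
    proof eventually_elim
      case (elim y)
      have "y / L y * tail y \<le> y / L y * functional (\<lambda>u. ramp (1/2) b u * capped_weight u) y"
        using elim b by (intro mult_left_mono up) auto
      then show ?case using elim by simp
    qed
  qed
qed

end

section \<open>The Abelian direction: from the tail to the Stieltjes transform\<close>

lemma kernel_primitive:
  assumes "x \<ge> (0::real)"
  shows "(\<integral>\<^sup>+ s. ennreal (2 * s / (1 + s) ^ 3) * indicator {0..x} s \<partial>lborel) = ennreal ((x / (x + 1))\<^sup>2)"
proof -
  have "(\<integral>\<^sup>+ s. ennreal (2 * s / (1 + s) ^ 3) * indicator {0..x} s \<partial>lborel)
      = (x / (x + 1))\<^sup>2 - (0 / (0 + 1))\<^sup>2"
  proof (rule nn_integral_FTC_Icc)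
    fix s :: real assume "s \<in> {0..x}"
    then have s: "0 \<le> s" "s \<le> x" by auto
    have "((\<lambda>s. (s / (s + 1))\<^sup>2) has_real_derivative
        2 * (s / (s + 1)) * ((1 * (s + 1) - s * 1) / ((s + 1) * (s + 1)))) (at s)"
      using s by (auto intro!: derivative_eq_intros)
    moreover have "2 * (s / (s + 1)) * ((1 * (s + 1) - s * 1) / ((s + 1) * (s + 1))) = 2 * s / (1 + s) ^ 3"
      using s by (simp add: power3_eq_cube add.commute)
    ultimately show "((\<lambda>s. (s / (s + 1))\<^sup>2) has_real_derivative 2 * s / (1 + s) ^ 3) (at s)"
      by metis
  qed (use assms in auto)
  then show ?thesis by simp
qed

lemma kernel_limit_integral: "(LINT s|lborel. (if s > 0 then 2 / (1 + s) ^ 3 else 0)) = (1 :: real)"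
proof -
  have "(\<integral>\<^sup>+ s. ennreal (2 / (1 + s) ^ 3) * indicator {0..} s \<partial>lborel) = ennreal (0 - (- (1 / (1 + 0)\<^sup>2)))"
  proof (rule nn_integral_FTC_atLeast)
    fix s :: real assume s: "0 \<le> s"
    have "((\<lambda>s. - (1 / (1 + s)\<^sup>2)) has_real_derivative
        - ((0 * (1 + s)\<^sup>2 - 1 * (2 * (1 + s))) / ((1 + s)\<^sup>2 * (1 + s)\<^sup>2))) (at s)"
      using s by (auto intro!: derivative_eq_intros)
    moreover have "- ((0 * (1 + s)\<^sup>2 - 1 * (2 * (1 + s))) / ((1 + s)\<^sup>2 * (1 + s)\<^sup>2)) = 2 / (1 + s) ^ 3"
    proof -
      have "1 + s \<noteq> 0" using s by simp
      then show ?thesis by (simp add: power3_eq_cube power2_eq_square divide_simps) (simp add: algebra_simps)?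
    qed
    ultimately show "((\<lambda>s. - (1 / (1 + s)\<^sup>2)) has_real_derivative 2 / (1 + s) ^ 3) (at s)" by simp
    show "0 \<le> 2 / (1 + s) ^ 3" using s by simp
  next
    show "((\<lambda>s::real. - (1 / (1 + s)\<^sup>2)) \<longlongrightarrow> 0) at_top" by real_asymp
  qed measurable
  moreover have "(\<integral>\<^sup>+ s. ennreal (2 / (1 + s) ^ 3) * indicator {0..} s \<partial>lborel)
      = (\<integral>\<^sup>+ s. ennreal (if s > 0 then 2 / (1 + s) ^ 3 else 0 :: real) \<partial>lborel)"
    by (rule nn_integral_cong_AE)
      (use AE_lborel_singleton[of "0::real"] in eventually_elim, auto simp: indicator_def)
  ultimately have "(\<integral>\<^sup>+ s. ennreal (if s > 0 then 2 / (1 + s) ^ 3 else 0 :: real) \<partial>lborel) = 1"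
    by simp
  then show ?thesis
    by (subst integral_eq_nn_integral) auto
qed

text \<open>This function is the dominating one in \<open>stieltjes_of_tail\<close>; its primitive is \<open>2 arctan \<surd>s\<close>.\<close>

lemma integrable_inverse_sqrt_kernel:
  "integrable lborel (\<lambda>s::real. if s > 0 then 1 / (sqrt s * (1 + s)) else 0)"
proof -
  have "set_integrable lborel (einterval 0 \<infinity>) (\<lambda>s::real. 1 / (sqrt s * (1 + s)))"
  proof (rule interval_integral_FTC_nonneg(1))
    fix s :: real assume "0 < ereal s"
    then have s: "s > 0" by (simp add: zero_ereal_def)
    have "((\<lambda>s. 2 * arctan (sqrt s)) has_real_derivative
        2 * (inverse (1 + (sqrt s)\<^sup>2) * (inverse (sqrt s) / 2))) (at s)"
      using s by (auto intro!: derivative_eq_intros)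
    moreover have "2 * (inverse (1 + (sqrt s)\<^sup>2) * (inverse (sqrt s) / 2)) = 1 / (sqrt s * (1 + s))"
      using s by (simp add: divide_simps) (simp add: algebra_simps)?
    ultimately show "((\<lambda>s. 2 * arctan (sqrt s)) has_real_derivative 1 / (sqrt s * (1 + s))) (at s)"
      by simp
    show "isCont (\<lambda>s. 1 / (sqrt s * (1 + s))) s"
      using s by (intro continuous_intros) auto
  next
    show "AE s in lborel. (0::ereal) < ereal s \<longrightarrow> ereal s < \<infinity> \<longrightarrow> 0 \<le> 1 / (sqrt s * (1 + s))"
      by (intro AE_I2) (auto simp: zero_ereal_def)
    have "((\<lambda>s. 2 * arctan (sqrt s)) \<longlongrightarrow> 2 * arctan (sqrt 0)) (at_right (0::real))"
      by (intro tendsto_intros)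
    then show "(((\<lambda>s. 2 * arctan (sqrt s)) \<circ> real_of_ereal) \<longlongrightarrow> 0) (at_right 0)"
      by (simp add: zero_ereal_def ereal_tendsto_simps)
    have "((\<lambda>s::real. 2 * arctan (sqrt s)) \<longlongrightarrow> 2 * (pi / 2)) at_top"
      by (intro tendsto_mult tendsto_const filterlim_compose[OF tendsto_arctan_at_top sqrt_at_top])
    then show "(((\<lambda>s. 2 * arctan (sqrt s)) \<circ> real_of_ereal) \<longlongrightarrow> pi) (at_left \<infinity>)"
      by (simp add: ereal_tendsto_simps)
  qed simp
  then show ?thesis
    unfolding set_integrable_def
    by (rule back_subst[where P = "integrable lborel"])
      (auto simp: einterval_def zero_ereal_def indicator_def fun_eq_iff)
qed

context half_line_distribution begin

lemma tail_nonneg: "0 \<le> tail x" and tail_le_1: "tail x \<le> 1"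
  by (simp_all add: tail_def)

lemma tail_antimono: "0 \<le> a \<Longrightarrow> a \<le> b \<Longrightarrow> tail b \<le> tail a"
  unfolding tail_def using tail_sets[of a] by (intro finite_measure_mono) auto

text \<open>For negative arguments the tail need not be monotone, because the set \<open>{x<..}\<close> is then no subset
of the underlying space; hence the truncation at \<open>0\<close>.\<close>

lemma measurable_tail: "(\<lambda>s. tail (max 0 s)) \<in> borel_measurable borel"
proof -
  have "mono (\<lambda>s. - tail (max 0 s))"
    by (intro monoI) (auto intro!: tail_antimono)
  then have "(\<lambda>s. - tail (max 0 s)) \<in> borel_measurable borel" by (rule borel_measurable_mono)
  then have "(\<lambda>s. - (- tail (max 0 s))) \<in> borel_measurable borel" by (rule borel_measurable_uminus)
  then show ?thesis by simp
qed

text \<open>Integration by parts in the form of Tonelli's theorem: \<open>(t/(t+y))\<^sup>2\<close> is the integral of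
\<open>2s/(1+s)\<^sup>3\<close> over \<open>0 < s < t/y\<close>.\<close>

lemma stieltjes_eq_tail_integral:
  assumes y: "y > 0"
  shows "stieltjes 0 y = (LINT s|lborel. (if s > 0 then 2 * s / (1 + s) ^ 3 * tail (s * y) else 0))"
proof -
  interpret pair_sigma_finite lborel \<mu> ..
  define k where "k = (\<lambda>s::real. if s > 0 then 2 * s / (1 + s) ^ 3 else 0)"
  have k[measurable]: "k \<in> borel_measurable borel" and k0: "k s \<ge> 0" for s
    by (auto simp: k_def)
  have inner: "(\<integral>\<^sup>+ s. ennreal (k s) * indicator {s<..} (t / y) \<partial>lborel) = ennreal ((t / (t + y))\<^sup>2)"
    if t: "t \<ge> 0" for t
  proof -
    have "(\<integral>\<^sup>+ s. ennreal (k s) * indicator {s<..} (t / y) \<partial>lborel)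
        = (\<integral>\<^sup>+ s. ennreal (2 * s / (1 + s) ^ 3) * indicator {0..t / y} s \<partial>lborel)"
      by (rule nn_integral_cong_AE)
        (use AE_lborel_singleton[of "0::real"] AE_lborel_singleton[of "t / y"] in eventually_elim,
          auto simp: indicator_def k_def)
    also have "\<dots> = ennreal ((t / y / (t / y + 1))\<^sup>2)"
      using t y by (intro kernel_primitive) simp
    also have "t / y / (t / y + 1) = t / (t + y)"
      using t y by (simp add: field_simps)
    finally show ?thesis .
  qed
  have "(\<integral>\<^sup>+ t. ennreal ((t / (t + y))\<^sup>2) \<partial>\<mu>)
      = (\<integral>\<^sup>+ t. (\<integral>\<^sup>+ s. ennreal (k s) * indicator {s<..} (t / y) \<partial>lborel) \<partial>\<mu>)"
    by (rule nn_integral_cong) (simp add: inner space_eq)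
  also have "\<dots> = (\<integral>\<^sup>+ s. (\<integral>\<^sup>+ t. ennreal (k s) * indicator {s<..} (t / y) \<partial>\<mu>) \<partial>lborel)"
    by (rule Fubini') (unfold indicator_def, simp add: case_prod_beta', measurable)
  also have "\<dots> = (\<integral>\<^sup>+ s. ennreal (if s > 0 then 2 * s / (1 + s) ^ 3 * tail (s * y) else 0) \<partial>lborel)"
  proof (rule nn_integral_cong)
    fix s :: real
    show "(\<integral>\<^sup>+ t. ennreal (k s) * indicator {s<..} (t / y) \<partial>\<mu>)
        = ennreal (if s > 0 then 2 * s / (1 + s) ^ 3 * tail (s * y) else 0)"
    proof (cases "s > 0")
      case True
      have ind: "indicator {s<..} (t / y) = (indicator {s * y<..} t :: ennreal)" for t
        using y by (auto simp: indicator_def pos_less_divide_eq)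
      have "{s * y<..} \<in> sets \<mu>" using True y by (intro tail_sets) simp
      then have "(\<integral>\<^sup>+ t. ennreal (k s) * indicator {s<..} (t / y) \<partial>\<mu>) = ennreal (k s) * ennreal (tail (s * y))"
        unfolding ind by (simp add: nn_integral_cmult_indicator tail_def emeasure_eq_measure)
      also have "\<dots> = ennreal (k s * tail (s * y))"
        by (simp add: ennreal_mult k0 tail_nonneg)
      finally show ?thesis using True by (simp add: k_def)
    qed (simp add: k_def)
  qed
  finally have nn: "(\<integral>\<^sup>+ t. ennreal ((t / (t + y))\<^sup>2) \<partial>\<mu>)
      = (\<integral>\<^sup>+ s. ennreal (if s > 0 then 2 * s / (1 + s) ^ 3 * tail (s * y) else 0) \<partial>lborel)" .
  have meas: "(\<lambda>s. if s > 0 then 2 * s / (1 + s) ^ 3 * tail (s * y) else 0) \<in> borel_measurable lborel"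
  proof -
    note measurable_point [measurable del]
    have [measurable]: "(\<lambda>s. tail (max 0 (s * y))) \<in> borel_measurable borel"
      by (rule measurable_compose[OF _ measurable_tail, of "\<lambda>s. s * y"]) simp
    have "(\<lambda>s. if s > 0 then 2 * s / (1 + s) ^ 3 * tail (max 0 (s * y)) else 0) \<in> borel_measurable lborel"
      by measurable
    also have "(\<lambda>s. if s > 0 then 2 * s / (1 + s) ^ 3 * tail (max 0 (s * y)) else 0)
        = (\<lambda>s. if s > 0 then 2 * s / (1 + s) ^ 3 * tail (s * y) else 0)"
      using y by (auto simp: fun_eq_iff max_def mult_less_0_iff)
    finally show ?thesis .
  qed
  have "stieltjes 0 y = enn2real (\<integral>\<^sup>+ t. ennreal ((t / (t + y))\<^sup>2) \<partial>\<mu>)"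
    unfolding stieltjes_def by (subst integral_eq_nn_integral) auto
  also have "\<dots> = (LINT s|lborel. (if s > 0 then 2 * s / (1 + s) ^ 3 * tail (s * y) else 0))"
    unfolding nn using meas by (subst integral_eq_nn_integral) (auto simp: tail_nonneg)
  finally show ?thesis .
qed

text \<open>Dominated convergence in the previous formula. For \<open>s \<ge> 1\<close> the quotient \<open>tail(sy)/tail(y)\<close> is at most
\<open>1\<close>. For \<open>s < 1\<close> it is \<open>O(s\<^bsup>-3/2\<^esup>)\<close>: any exponent strictly between \<open>1\<close> and \<open>2\<close> exceeds the index of the tail
and leaves \<open>s \<cdot> s\<^bsup>-3/2\<^esup>\<close> integrable at \<open>0\<close>.\<close>

lemma stieltjes_of_tail:
  assumes pos: "\<And>x. x \<ge> 0 \<Longrightarrow> tail x > 0"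
    and rv: "\<And>l. l > 0 \<Longrightarrow> ((\<lambda>x. tail (l * x) / tail x) \<longlongrightarrow> 1 / l) at_top"
  shows "((\<lambda>y. stieltjes 0 y / tail y) \<longlongrightarrow> 1) at_top"
proof -
  have "((\<lambda>x. tail x / tail (exp 1 * x)) \<longlongrightarrow> exp 1) at_top"
    using tendsto_inverse[OF rv[of "exp 1"]] by simp
  then have "\<forall>\<^sub>F x in at_top. tail x / tail (exp 1 * x) < exp (3 / 2)"
    by (rule order_tendstoD) simp
  then obtain X0 where X0: "\<And>x. x \<ge> X0 \<Longrightarrow> tail x / tail (exp 1 * x) < exp (3 / 2)"
    by (auto simp: eventually_at_top_linorder)
  define X where "X = max 1 X0"
  have X: "X > 0" "X \<ge> X0" by (auto simp: X_def)
  have potter: "tail a \<le> exp (3/2) * tail b * (b / a) powr (3/2)" if a: "X \<le> a" and ab: "a \<le> b" for a b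
  proof -
    have a0: "a > 0" using a X by simp
    have "1 / tail b \<le> exp (3/2) * (1 / tail a) * (b / a) powr (3/2)"
    proof (rule power_growth_bound[OF a0 _ _ _ ab])
      fix x u :: real assume x: "a \<le> x" and u: "1 \<le> u" "u \<le> exp 1"
      have x0: "x > 0" using x a0 by simp
      have "tail (exp 1 * x) \<le> tail (u * x)" using u x0 by (intro tail_antimono) auto
      moreover have "tail (exp 1 * x) > 0" using x0 by (intro pos) simp
      moreover have "tail x > 0" using x0 by (intro pos) simp
      moreover have "tail x / tail (exp 1 * x) < exp (3 / 2)" using X0[of x] x a X by simp
      ultimately have "1 / tail (u * x) \<le> 1 / tail (exp 1 * x)" "1 / tail (exp 1 * x) \<le> exp (3/2) / tail x"
        by (auto intro!: divide_left_mono simp: field_simps)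
      then show "1 / tail (u * x) \<le> exp (3/2) * (1 / tail x)" by simp
    qed (auto intro: less_imp_le simp: tail_nonneg)
    then show ?thesis using pos[of a] pos[of b] a0 ab by (simp add: field_simps)
  qed
  \<comment> \<open>covers both \<open>sy \<ge> X\<close>, where the bound of Potter type applies, and \<open>sy < X\<close>, where the tail at \<open>sy\<close> is at most \<open>1\<close>\<close>
  define C where "C = exp (3/2) / tail X"
  have C: "C > 0" "exp (3/2) \<le> C" "1 \<le> C"
  proof -
    have tX: "0 < tail X" "tail X \<le> 1" using pos[of X] X tail_le_1 by auto
    then show "C > 0" by (simp add: C_def)
    show e: "exp (3/2) \<le> C" unfolding C_def using tX by (simp add: le_divide_eq mult_left_le)
    have "1 \<le> exp (3/2 :: real)" by simp
    then show "1 \<le> C" using e by linarith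
  qed
  have small: "tail (s * y) / tail y \<le> C * s powr (- (3/2))" if y: "y \<ge> X" and s: "0 < s" "s \<le> 1" for s y
  proof -
    have y0: "y > 0" and ty: "tail y > 0" using y X pos[of y] by auto
    have inv: "(1 / s) powr (3/2) = s powr (- (3/2))" using s by (simp add: powr_divide powr_minus_divide)
    have "tail (s * y) \<le> C * tail y * (1 / s) powr (3/2)"
    proof (cases "X \<le> s * y")
      case True
      have "tail (s * y) \<le> exp (3/2) * tail y * (y / (s * y)) powr (3/2)"
        using True s y0 by (intro potter) auto
      also have "y / (s * y) = 1 / s" using y0 by simp
      also have "exp (3/2) * tail y * (1 / s) powr (3/2) \<le> C * tail y * (1 / s) powr (3/2)"
        using C(2) ty by (intro mult_right_mono) auto
      finally show ?thesis .
    next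
      case False
      have "tail X \<le> exp (3/2) * tail y * (y / X) powr (3/2)" using y by (intro potter) auto
      also have "\<dots> \<le> exp (3/2) * tail y * (1 / s) powr (3/2)"
        using False s X y0 ty by (intro mult_left_mono powr_mono2) (auto simp: field_simps)
      finally have "1 \<le> exp (3/2) * tail y * (1 / s) powr (3/2) / tail X"
        using pos[of X] X by (simp add: le_divide_eq)
      also have "\<dots> = C * tail y * (1 / s) powr (3/2)" by (simp add: C_def)
      finally show ?thesis using tail_le_1[of "s * y"] by linarith
    qed
    then show ?thesis using ty unfolding inv by (simp add: divide_le_eq mult_ac)
  qed
  \<comment> \<open>one integrable function that dominates both ranges: of order \<open>s\<^bsup>-1/2\<^esup>\<close> at \<open>0\<close> and \<open>s\<^bsup>-3/2\<^esup>\<close> at infinity\<close>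
  define w where "w = (\<lambda>s::real. if s > 0 then 2 * C * (1 / (sqrt s * (1 + s))) else 0)"
  have bound: "2 * s / (1 + s) ^ 3 * (tail (s * y) / tail y) \<le> w s" if y: "y \<ge> X" and s: "s > 0" for s y
  proof (cases "s \<le> 1")
    case True
    have p: "s * s powr (- (3/2)) = 1 / sqrt s"
    proof -
      have "s * s powr (- (3/2)) = s powr (1 + - (3/2))"
        using s by (subst powr_add) simp
      also have "\<dots> = 1 / sqrt s" using s by (simp add: powr_minus_divide powr_half_sqrt)
      finally show ?thesis .
    qed
    have "2 * s / (1 + s) ^ 3 * (tail (s * y) / tail y) \<le> 2 * s / (1 + s) ^ 3 * (C * s powr (- (3/2)))"
      using small[OF y s True] s by (intro mult_left_mono) auto
    also have "\<dots> = 2 * C * (s * s powr (- (3/2))) / (1 + s) ^ 3" by simp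
    also have "\<dots> = 2 * C / sqrt s / (1 + s) ^ 3" unfolding p by simp
    also have "\<dots> \<le> 2 * C / sqrt s / (1 + s)"
      using s C power_increasing[of 1 3 "1 + s"] by (intro divide_left_mono) auto
    finally show ?thesis using s by (simp add: w_def)
  next
    case False
    have y0: "y > 0" using y X by simp
    have "tail (s * y) \<le> tail y" using False y0 by (intro tail_antimono) auto
    then have r: "tail (s * y) / tail y \<le> C" using pos[of y] y0 C by (simp add: divide_le_eq order_trans[OF _ mult_right_mono[of 1 C]])
    have "s * sqrt s \<le> (1 + s)\<^sup>2"
    proof -
      have "sqrt s \<le> s" using False by (simp add: real_sqrt_le_iff' real_le_lsqrt power2_eq_square)
      then have "s * sqrt s \<le> s * s" using s by simp
      also have "\<dots> \<le> (1 + s)\<^sup>2" using s by (simp add: power2_eq_square field_simps)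
      finally show ?thesis .
    qed
    then have "s / (1 + s)\<^sup>2 \<le> 1 / sqrt s" using s by (simp add: field_simps)
    then have "s / (1 + s)\<^sup>2 / (1 + s) \<le> 1 / sqrt s / (1 + s)"
      using s by (intro divide_right_mono) auto
    moreover have "2 * s / (1 + s) ^ 3 = 2 * (s / (1 + s)\<^sup>2 / (1 + s))"
      by (simp add: power3_eq_cube power2_eq_square mult_ac)
    moreover have "1 / (sqrt s * (1 + s)) = 1 / sqrt s / (1 + s)" by simp
    ultimately have k: "2 * s / (1 + s) ^ 3 \<le> 2 * (1 / (sqrt s * (1 + s)))" by linarith
    have "2 * s / (1 + s) ^ 3 * (tail (s * y) / tail y) \<le> 2 * (1 / (sqrt s * (1 + s))) * C"
      using k r s tail_nonneg C by (intro mult_mono) auto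
    then show ?thesis using s by (simp add: w_def mult_ac)
  qed
  have meas: "(\<lambda>s. if s > 0 then 2 * s / (1 + s) ^ 3 * (tail (s * y) / tail y) else 0) \<in> borel_measurable lborel"
    if y: "y > 0" for y
  proof -
    note measurable_point [measurable del]
    have [measurable]: "(\<lambda>s. tail (max 0 (s * y))) \<in> borel_measurable borel"
      by (rule measurable_compose[OF _ measurable_tail, of "\<lambda>s. s * y"]) simp
    have "(\<lambda>s. if s > 0 then 2 * s / (1 + s) ^ 3 * (tail (max 0 (s * y)) / tail y) else 0) \<in> borel_measurable lborel"
      by measurable
    also have "(\<lambda>s. if s > 0 then 2 * s / (1 + s) ^ 3 * (tail (max 0 (s * y)) / tail y) else 0)
        = (\<lambda>s. if s > 0 then 2 * s / (1 + s) ^ 3 * (tail (s * y) / tail y) else 0)"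
      using y by (auto simp: fun_eq_iff max_def mult_less_0_iff)
    finally show ?thesis .
  qed
  \<comment> \<open>dominated convergence asks for measurability at every \<open>y\<close>, hence \<open>max 1 y\<close>, which is \<open>y\<close> in the limit\<close>
  have "((\<lambda>y. (LINT s|lborel. (if s > 0 then 2 * s / (1 + s) ^ 3 * (tail (s * max 1 y) / tail (max 1 y)) else 0)))
      \<longlongrightarrow> (LINT s|lborel. (if s > 0 then 2 / (1 + s) ^ 3 else 0))) at_top"
  proof (rule integral_dominated_convergence_at_top[where w = w])
    show "integrable lborel w"
    proof -
      have "w = (\<lambda>s. 2 * C * (if s > 0 then 1 / (sqrt s * (1 + s)) else 0))"
        by (auto simp: w_def fun_eq_iff)
      then show ?thesis using integrable_inverse_sqrt_kernel by simp
    qed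
    show "\<forall>\<^sub>F y in at_top. AE s in lborel.
        norm (if s > 0 then 2 * s / (1 + s) ^ 3 * (tail (s * max 1 y) / tail (max 1 y)) else 0) \<le> w s"
      using eventually_ge_at_top[of X]
    proof eventually_elim
      case (elim y)
      then have "max 1 y \<ge> X" by simp
      show ?case
      proof (rule AE_I2)
        fix s :: real
        show "norm (if s > 0 then 2 * s / (1 + s) ^ 3 * (tail (s * max 1 y) / tail (max 1 y)) else 0) \<le> w s"
          using bound[OF \<open>max 1 y \<ge> X\<close>, of s] by (auto simp: tail_nonneg w_def)
      qed
    qed
    show "AE s in lborel. ((\<lambda>y. if s > 0 then 2 * s / (1 + s) ^ 3 * (tail (s * max 1 y) / tail (max 1 y)) else 0)
        \<longlongrightarrow> (if s > 0 then 2 / (1 + s) ^ 3 else 0)) at_top"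
    proof (rule AE_I2)
      fix s :: real
      show "((\<lambda>y. if s > 0 then 2 * s / (1 + s) ^ 3 * (tail (s * max 1 y) / tail (max 1 y)) else 0)
        \<longlongrightarrow> (if s > 0 then 2 / (1 + s) ^ 3 else 0)) at_top"
      proof (cases "s > 0")
        case True
        have "filterlim (\<lambda>y::real. max 1 y) at_top at_top" by real_asymp
        then have "((\<lambda>y. 2 * s / (1 + s) ^ 3 * (tail (s * max 1 y) / tail (max 1 y)))
            \<longlongrightarrow> 2 * s / (1 + s) ^ 3 * (1 / s)) at_top"
          by (rule tendsto_mult[OF tendsto_const filterlim_compose[OF rv[OF True]]])
        then show ?thesis using True by simp
      qed simp
    qed
  qed (use meas in auto)
  then have lim: "((\<lambda>y. (LINT s|lborel. (if s > 0 then 2 * s / (1 + s) ^ 3 * (tail (s * max 1 y) / tail (max 1 y)) else 0)))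
      \<longlongrightarrow> 1) at_top"
    unfolding kernel_limit_integral .
  show ?thesis
  proof (rule Lim_transform_eventually[OF lim])
    show "\<forall>\<^sub>F y in at_top. (LINT s|lborel. (if s > 0 then 2 * s / (1 + s) ^ 3 * (tail (s * max 1 y) / tail (max 1 y)) else 0))
        = stieltjes 0 y / tail y"
      using eventually_ge_at_top[of 1]
    proof eventually_elim
      case (elim y)
      have "(LINT s|lborel. (if s > 0 then 2 * s / (1 + s) ^ 3 * (tail (s * max 1 y) / tail (max 1 y)) else 0))
          = (LINT s|lborel. (if s > 0 then 2 * s / (1 + s) ^ 3 * tail (s * y) else 0) / tail y)"
        using elim by (intro Bochner_Integration.integral_cong) auto
      also have "\<dots> = stieltjes 0 y / tail y"
        using elim by (simp add: stieltjes_eq_tail_integral)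
      finally show ?case .
    qed
  qed
qed

text \<open>For the Abelian half, the tail inherits positivity and regular variation of index \<open>-1\<close> from \<open>L(y)/y\<close>;
positivity on all of \<open>[0,\<infinity>)\<close>, not just eventually, comes from monotonicity.\<close>

lemma tail_iff_stieltjes:
  fixes L :: "real \<Rightarrow> real"
  assumes L: "\<forall>\<^sub>F x in at_top. L x > 0"
    and slow: "\<And>l. l > 0 \<Longrightarrow> ((\<lambda>x. L (l * x) / L x) \<longlongrightarrow> 1) at_top"
  shows "((\<lambda>y. y * tail y / L y) \<longlongrightarrow> 1) at_top \<longleftrightarrow> ((\<lambda>y. y * stieltjes 0 y / L y) \<longlongrightarrow> 1) at_top"
proof
  assume "((\<lambda>y. y * stieltjes 0 y / L y) \<longlongrightarrow> 1) at_top"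
  then show "((\<lambda>y. y * tail y / L y) \<longlongrightarrow> 1) at_top" by (intro tail_of_stieltjes L slow)
next
  assume lim: "((\<lambda>y. y * tail y / L y) \<longlongrightarrow> 1) at_top"
  have ev_pos: "\<forall>\<^sub>F y in at_top. tail y > 0"
    using order_tendstoD(1)[OF lim zero_less_one] L eventually_gt_at_top[of 0]
    by eventually_elim (auto simp: zero_less_divide_iff zero_less_mult_iff)
  have pos: "tail x > 0" if "x \<ge> 0" for x
  proof -
    obtain y where "y \<ge> x" "tail y > 0"
      using eventually_happens'[OF _ eventually_conj[OF ev_pos eventually_ge_at_top[of x]]] by auto
    then show ?thesis using tail_antimono[OF that, of y] by simp
  qed
  have rv: "((\<lambda>x. tail (l * x) / tail x) \<longlongrightarrow> 1 / l) at_top" if l: "l > 0" for l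
  proof -
    have lx: "filterlim (\<lambda>x. l * x) at_top at_top" using l by real_asymp
    have "((\<lambda>x. (l * x * tail (l * x) / L (l * x)) / (x * tail x / L x) * (L (l * x) / L x) / l)
        \<longlongrightarrow> 1 / 1 * 1 / l) at_top"
      using l by (intro tendsto_mult tendsto_divide tendsto_const slow l lim filterlim_compose[OF lim lx]) auto
    moreover have "\<forall>\<^sub>F x in at_top. L (l * x) > 0"
      using L by (rule eventually_compose_filterlim) (rule lx)
    then have "\<forall>\<^sub>F x in at_top. (l * x * tail (l * x) / L (l * x)) / (x * tail x / L x) * (L (l * x) / L x) / l
        = tail (l * x) / tail x"
      using L eventually_gt_at_top[of 0] by eventually_elim (use l in simp)
    ultimately show ?thesis using Lim_transform_eventually by fastforce
  qed
  have "((\<lambda>y. stieltjes 0 y / tail y * (y * tail y / L y)) \<longlongrightarrow> 1 * 1) at_top"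
    by (intro tendsto_mult lim stieltjes_of_tail pos rv)
  moreover have "\<forall>\<^sub>F y in at_top. stieltjes 0 y / tail y * (y * tail y / L y) = y * stieltjes 0 y / L y"
    using ev_pos by eventually_elim simp
  ultimately show "((\<lambda>y. y * stieltjes 0 y / L y) \<longlongrightarrow> 1) at_top"
    using Lim_transform_eventually by fastforce
qed

section \<open>The change of variables given by the S-transform\<close>

definition level :: "real \<Rightarrow> real" where
  "level y = y / parallel_mean y"

text \<open>The argument of \<open>L\<close> in the auxiliary function \<open>M\<close>. It inverts \<open>level\<close>, which is \<open>level_inv_level\<close> and
\<open>level_inv_props\<close> below.\<close>

definition level_inv :: "real \<Rightarrow> real" where
  "level_inv x = (x - 1) / S_transform \<mu> (- 1 / x)"

text \<open>Minus the Cauchy transform at \<open>-y\<close>. In terms of it \<open>1/S(-1/x) = 1/resolvent y - y\<close> for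
\<open>x = level y\<close>.\<close>

definition resolvent :: "real \<Rightarrow> real" where
  "resolvent y = (LINT t|\<mu>. 1 / (t + y))"

lemma integrable_resolvent:
  assumes "y > 0"
  shows "integrable \<mu> (\<lambda>t. 1 / (t + y))"
  by (rule bounded_imp_integrable[where C = "1 / y"]) (use assms in \<open>auto intro!: divide_left_mono\<close>)

lemma resolvent_pos: "y > 0 \<Longrightarrow> resolvent y > 0"
  unfolding resolvent_def by (rule integral_pos_half_line[OF integrable_resolvent]) auto

lemma parallel_mean_resolvent:
  assumes y: "y > 0"
  shows "parallel_mean y = y * (1 - y * resolvent y)"
proof -
  have "parallel_mean y = (LINT t|\<mu>. y * 1 - y * (y * (1 / (t + y))))"
    unfolding parallel_mean_def
    by (intro Bochner_Integration.integral_cong) (use y in \<open>auto simp: space_eq field_simps\<close>)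
  also have "\<dots> = (LINT t|\<mu>. y * 1) - (LINT t|\<mu>. y * (y * (1 / (t + y))))"
    by (intro Bochner_Integration.integral_diff integrable_mult_right integrable_resolvent y) simp
  also have "\<dots> = y - y * (y * resolvent y)"
    unfolding resolvent_def integral_mult_right_zero by (simp add: prob_space)
  finally show ?thesis by (simp add: right_diff_distrib)
qed

lemma inverse_level: "y > 0 \<Longrightarrow> 1 / level y = 1 - y * resolvent y"
  by (simp add: level_def parallel_mean_resolvent)

lemma inverse_level_integral:
  assumes y: "y > 0"
  shows "1 / level y = (LINT t|\<mu>. t / (t + y))"
proof -
  have "parallel_mean y = (LINT t|\<mu>. y * (t / (t + y)))" unfolding parallel_mean_def by (simp add: mult.commute)
  also have "\<dots> = y * (LINT t|\<mu>. t / (t + y))" by (rule integral_mult_right_zero)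
  finally show ?thesis using y by (simp add: level_def)
qed

lemma level_gt_1:
  assumes y: "y > 0"
  shows "level y > 1"
proof -
  have "level y > 0" unfolding level_def using y parallel_mean_pos[OF y] by simp
  moreover have "1 / level y < 1" using inverse_level[OF y] y resolvent_pos[OF y] by simp
  ultimately show ?thesis by simp
qed

lemma resolvent_increment:
  assumes ab: "0 < a" "a < b"
  shows "resolvent a - resolvent b = (b - a) * (LINT t|\<mu>. 1 / (t + a) * (1 / (t + b)))"
proof -
  have "resolvent a - resolvent b = (LINT t|\<mu>. 1 / (t + a) - 1 / (t + b))"
    unfolding resolvent_def using ab
    by (intro Bochner_Integration.integral_diff[symmetric] integrable_resolvent) auto
  also have "\<dots> = (LINT t|\<mu>. (b - a) * (1 / (t + a) * (1 / (t + b))))"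
    by (intro Bochner_Integration.integral_cong) (use ab in \<open>auto simp: space_eq field_simps\<close>)
  also have "\<dots> = (b - a) * (LINT t|\<mu>. 1 / (t + a) * (1 / (t + b)))"
    by (rule integral_mult_right_zero)
  finally show ?thesis .
qed

text \<open>Two decreasing functions of \<open>t\<close> are positively correlated. The point \<open>c\<close> is where \<open>1/(t+a)\<close> takes its mean;
the product of the two centred functions is nonnegative on either side of it.\<close>

lemma resolvent_correlation:
  assumes ab: "0 < a" "0 < b"
  shows "resolvent a * resolvent b \<le> (LINT t|\<mu>. 1 / (t + a) * (1 / (t + b)))"
proof -
  \<comment> \<open>chosen so that \<open>1/(c+a)\<close> is the mean of \<open>1/(t+a)\<close>; the constant for the second factor then cancels\<close>
  define c where "c = 1 / resolvent a - a"
  have ca: "1 / (c + a) = resolvent a" and c0: "c + a > 0"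
    using resolvent_pos[OF ab(1)] by (auto simp: c_def)
  have "c \<ge> 0"
  proof -
    have "resolvent a \<le> (LINT t|\<mu>. 1 / a)"
      unfolding resolvent_def using ab
      by (intro integral_mono_half_line integrable_resolvent) (auto intro!: divide_left_mono)
    then have "resolvent a \<le> 1 / a" by (simp add: prob_space)
    then show ?thesis using resolvent_pos[OF ab(1)] ab by (simp add: c_def field_simps)
  qed
  have int: "integrable \<mu> (\<lambda>t. 1 / (t + a) * (1 / (t + b)))"
  proof (rule bounded_imp_integrable[where C = "1 / a * (1 / b)"])
    fix t :: real assume "t \<ge> 0"
    then show "\<bar>1 / (t + a) * (1 / (t + b))\<bar> \<le> 1 / a * (1 / b)"
      using ab unfolding abs_mult by (intro mult_mono) (auto intro!: divide_left_mono)
  qed measurable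
  have "0 \<le> (LINT t|\<mu>. (1 / (t + a) - 1 / (c + a)) * (1 / (t + b) - 1 / (c + b)))"
  proof (rule integral_nonneg_AE, rule AE_I2)
    fix t assume "t \<in> space \<mu>"
    then have t: "t \<ge> 0" by (simp add: space_eq)
    show "0 \<le> (1 / (t + a) - 1 / (c + a)) * (1 / (t + b) - 1 / (c + b))"
    proof (cases "t \<le> c")
      case True
      then show ?thesis using t \<open>c \<ge> 0\<close> ab by (intro mult_nonneg_nonneg) (simp_all add: frac_le)
    next
      case False
      then show ?thesis using t \<open>c \<ge> 0\<close> ab by (intro mult_nonpos_nonpos) (simp_all add: frac_le)
    qed
  qed
  also have "\<dots> = (LINT t|\<mu>. 1 / (t + a) * (1 / (t + b))) - resolvent a * resolvent b"
  proof -
    define u v where "u = (\<lambda>t. 1 / (t + a))" and "v = (\<lambda>t. 1 / (t + b))"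
    have uv: "integrable \<mu> u" "integrable \<mu> v" "integrable \<mu> (\<lambda>t. u t * v t)"
        "integral\<^sup>L \<mu> u = resolvent a" "integral\<^sup>L \<mu> v = resolvent b"
      using int integrable_resolvent[OF ab(1)] integrable_resolvent[OF ab(2)]
      by (auto simp: u_def v_def resolvent_def)
    have "(LINT t|\<mu>. (u t - resolvent a) * (v t - d)) = (LINT t|\<mu>. u t * v t - d * u t - resolvent a * v t + resolvent a * d)" for d
      by (simp add: algebra_simps)
    also have "\<dots> d = (LINT t|\<mu>. u t * v t) - resolvent a * resolvent b" for d
      using uv by (simp add: prob_space)
    finally show ?thesis unfolding u_def v_def ca .
  qed
  finally show ?thesis by simp
qed

text \<open>This is the monotonicity of the \<open>S\<close>-transform, since \<open>1/resolvent y - y\<close> equals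
\<open>1/S(-1/level y)\<close>.\<close>

lemma inverse_resolvent_minus_id_mono:
  assumes ab: "0 < a" "a < b"
  shows "1 / resolvent a - a \<le> 1 / resolvent b - b"
proof -
  have pos: "resolvent a > 0" "resolvent b > 0" using resolvent_pos ab by auto
  have "(b - a) * (resolvent a * resolvent b) \<le> resolvent a - resolvent b"
    unfolding resolvent_increment[OF ab] using ab by (intro mult_left_mono resolvent_correlation) auto
  then show ?thesis using pos by (simp add: field_simps)
qed

lemma level_strict_mono:
  assumes ab: "0 < a" "a < b"
  shows "level a < level b"
proof -
  have b: "0 < b" using ab by simp
  have int: "integrable \<mu> (\<lambda>t. t / (t + y))" if "y > 0" for y
    by (rule bounded_imp_integrable[where C = 1]) (use that in auto)
  have "0 < (LINT t|\<mu>. t / (t + a) - t / (t + b))"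
    by (rule integral_pos_half_line[OF Bochner_Integration.integrable_diff[OF int[OF ab(1)] int[OF b]]])
      (use ab in \<open>auto intro!: divide_left_mono divide_strict_left_mono mult_pos_pos\<close>)
  also have "\<dots> = 1 / level a - 1 / level b"
    using int ab b by (simp add: inverse_level_integral)
  finally show ?thesis using level_gt_1[OF ab(1)] level_gt_1[OF b] by (simp add: field_simps)
qed

lemma level_less_iff: "0 < a \<Longrightarrow> 0 < b \<Longrightarrow> level a < level b \<longleftrightarrow> a < b"
  by (metis level_strict_mono less_asym not_less_iff_gr_or_eq)

lemma parallel_mean_mono:
  assumes ab: "0 < a" "a \<le> b"
  shows "parallel_mean a \<le> parallel_mean b"
proof (cases "a = b")
  case False
  have "0 \<le> (b - a) * stieltjes 0 b" using ab stieltjes_pos[of b 0] by simp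
  then show ?thesis using parallel_mean_increment(1)[of a b] ab False by simp
qed simp

text \<open>The Lipschitz bounds give continuity of \<open>level\<close>, and also that it maps Lebesgue null sets to null sets,
which is what Lebesgue measurability of \<open>L \<circ> level_inv\<close> depends on.\<close>

lemma inverse_level_Lipschitz:
  assumes ab: "1 \<le> a" "a \<le> b"
  shows "1 / level a - 1 / level b \<le> b - a"
proof -
  have pos: "parallel_mean a \<le> a"
    using level_gt_1[of a] parallel_mean_pos[of a] ab by (simp add: level_def)
  have "parallel_mean a \<le> parallel_mean b" using ab by (intro parallel_mean_mono) auto
  then have "1 / level a - 1 / level b \<le> parallel_mean a / a - parallel_mean a / b"
    using ab by (simp add: level_def divide_right_mono)
  also have "\<dots> = (b - a) * (parallel_mean a / a) / b" using ab by (simp add: field_simps)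
  also have "\<dots> \<le> (b - a) * 1 / 1"
    using ab pos parallel_mean_pos[of a] by (intro frac_le mult_left_mono) auto
  finally show ?thesis by simp
qed

lemma level_Lipschitz:
  assumes a: "1 \<le> a" "a \<le> c" and b: "1 \<le> b" "b \<le> c"
  shows "\<bar>level a - level b\<bar> \<le> (level c)\<^sup>2 * \<bar>a - b\<bar>"
proof -
  have *: "level b - level a \<le> (level c)\<^sup>2 * (b - a)" if ab: "1 \<le> a" "a \<le> b" "b \<le> c" for a b
  proof -
    have pos: "level a > 0" "level b > 0" using level_gt_1[of a] level_gt_1[of b] ab by auto
    have le: "level a \<le> level c" "level b \<le> level c"
      using level_less_iff[of c a] level_less_iff[of c b] ab by auto
    have "level b - level a = level a * level b * (1 / level a - 1 / level b)"
      using pos by (simp add: field_simps)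
    also have "\<dots> \<le> level c * level c * (b - a)"
    proof (intro mult_mono inverse_level_Lipschitz)
      have "level a \<le> level b" using level_less_iff[of b a] ab by auto
      then show "0 \<le> 1 / level a - 1 / level b" using pos by (simp add: frac_le)
    qed (use pos le ab in auto)
    finally show ?thesis by (simp add: power2_eq_square)
  qed
  have mono: "level a \<le> level b" if "1 \<le> a" "a \<le> b" for a b
    using level_less_iff[of b a] that by auto
  show ?thesis
    using *[of a b] *[of b a] mono[of a b] mono[of b a] a b by (cases "a \<le> b") (auto simp: abs_if)
qed

lemma level_at_top: "filterlim level at_top at_top"
proof -
  \<comment> \<open>the bound \<open>max 1 y\<close> keeps the denominators positive for every \<open>y\<close>\<close>
  have lim: "((\<lambda>y. LINT t|\<mu>. t / (t + max 1 y)) \<longlongrightarrow> (LINT t|\<mu>. 0)) at_top"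
  proof (rule integral_dominated_convergence_at_top[where w = "\<lambda>_. 1"])
    show "\<forall>\<^sub>F y in at_top. AE t in \<mu>. norm (t / (t + max 1 y)) \<le> 1"
      by (intro always_eventually allI AE_I2) (auto simp: space_eq)
    show "AE t in \<mu>. ((\<lambda>y. t / (t + max 1 y)) \<longlongrightarrow> 0) at_top"
      by (intro AE_I2) real_asymp
  qed auto
  have "((\<lambda>y. inverse (level y)) \<longlongrightarrow> 0) at_top"
  proof (rule Lim_transform_eventually)
    show "((\<lambda>y. LINT t|\<mu>. t / (t + max 1 y)) \<longlongrightarrow> 0) at_top" using lim by simp
    show "\<forall>\<^sub>F y in at_top. (LINT t|\<mu>. t / (t + max 1 y)) = inverse (level y)"
      using eventually_ge_at_top[of 1]
    proof eventually_elim
      case (elim y)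
      then show ?case using inverse_level_integral[of y] by (simp add: inverse_eq_divide)
    qed
  qed
  then show ?thesis
    using filterlim_inverse_at_top[of "\<lambda>y. inverse (level y)" at_top]
    by (simp add: eventually_mono[OF eventually_gt_at_top[of 0]] order_less_trans[OF zero_less_one level_gt_1])
qed

lemma level_continuous: "continuous_on {1..} level"
proof (rule continuous_on_eq_continuous_within[THEN iffD2], rule ballI)
  fix x :: real assume x: "x \<in> {1..}"
  show "continuous (at x within {1..}) level"
    unfolding continuous_within
  proof (rule Lim_null[THEN iffD2], rule Lim_null_comparison)
    show "\<forall>\<^sub>F y in at x within {1..}. norm (level y - level x) \<le> (level (x + 1))\<^sup>2 * \<bar>y - x\<bar>"
      unfolding eventually_at
      by (rule exI[of _ 1]) (use x in \<open>auto simp: dist_real_def intro!: level_Lipschitz\<close>)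
    have "((\<lambda>y. (level (x + 1))\<^sup>2 * \<bar>y - x\<bar>) \<longlongrightarrow> (level (x + 1))\<^sup>2 * \<bar>x - x\<bar>) (at x within {1..})"
      by (intro tendsto_intros)
    then show "((\<lambda>y. (level (x + 1))\<^sup>2 * \<bar>y - x\<bar>) \<longlongrightarrow> 0) (at x within {1..})" by simp
  qed
qed

lemma psi_transform_level:
  assumes y: "y > 0"
  shows "psi_transform \<mu> (- 1 / y) = - 1 / level y"
proof -
  have "psi_transform \<mu> (- 1 / y) = (LINT t|\<mu>. - (1 / y) * (t * y / (t + y)))"
    unfolding psi_transform_def
    by (intro Bochner_Integration.integral_cong) (use y in \<open>auto simp: space_eq divide_simps\<close>)
  also have "\<dots> = - (1 / y) * parallel_mean y" unfolding parallel_mean_def by (rule integral_mult_right_zero)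
  finally show ?thesis by (simp add: level_def)
qed

lemma psi_transform_inj: "inj_on (psi_transform \<mu>) {..<0}"
proof (rule inj_onI)
  fix z w assume zw: "z \<in> {..<0}" "w \<in> {..<0}" and eq: "psi_transform \<mu> z = psi_transform \<mu> w"
  define a b where "a = - 1 / z" and "b = - 1 / w"
  have ab: "a > 0" "b > 0" "z = - 1 / a" "w = - 1 / b"
    using zw by (auto simp: a_def b_def divide_neg_neg)
  have "1 / level a = 1 / level b" using eq ab psi_transform_level by simp
  then have "level a = level b" by simp
  then show "z = w" using level_less_iff[of a b] level_less_iff[of b a] ab by fastforce
qed

lemma level_inv_level:
  assumes y: "y > 0"
  shows "level_inv (level y) = y"
proof -
  have "chi_transform \<mu> (- 1 / level y) = - 1 / y"
    unfolding chi_transform_def psi_transform_level[OF y, symmetric]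
    using y by (intro the_inv_into_f_f psi_transform_inj) simp
  then have "S_transform \<mu> (- 1 / level y) = (- 1 / level y + 1) / (- 1 / level y) * (- 1 / y)"
    unfolding S_transform_def by (rule arg_cong)
  also have "\<dots> = (level y - 1) / y"
    using level_gt_1[OF y] y by (simp add: field_simps)
  finally have "S_transform \<mu> (- 1 / level y) = (level y - 1) / y" .
  then show ?thesis using level_gt_1[OF y] y by (simp add: level_inv_def)
qed

lemma level_inv_props:
  assumes x: "x \<ge> level 1"
  shows "level (level_inv x) = x" "level_inv x \<ge> 1"
proof -
  have "\<forall>\<^sub>F y in at_top. level y \<ge> x \<and> y \<ge> 1"
    using level_at_top by (auto simp: filterlim_at_top intro: eventually_conj eventually_ge_at_top)
  then obtain b where b: "level b \<ge> x" "b \<ge> 1"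
    using eventually_happens'[of at_top] by force
  obtain y where "1 \<le> y" "y \<le> b" "level y = x"
    using IVT'[of level 1 x b] x b continuous_on_subset[OF level_continuous] by auto
  then show "level (level_inv x) = x" "level_inv x \<ge> 1" using level_inv_level[of y] by auto
qed

lemma level_inv_gt_iff:
  assumes "x \<ge> level 1" "y > 0"
  shows "y < level_inv x \<longleftrightarrow> level y < x"
  using level_less_iff[of y "level_inv x"] level_inv_props[OF assms(1)] assms(2) by simp

lemma level_inv_less_iff:
  assumes "x \<ge> level 1" "y > 0"
  shows "level_inv x < y \<longleftrightarrow> x < level y"
  using level_less_iff[of "level_inv x" y] level_inv_props[OF assms(1)] assms(2) by simp

lemma level_inv_mono:
  assumes "level 1 \<le> x" "x \<le> x'"
  shows "level_inv x \<le> level_inv x'"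
  using level_inv_less_iff[of x' "level_inv x"] level_inv_props[of x] assms by (auto simp: not_less[symmetric])

lemma level_inv_at_top: "filterlim level_inv at_top at_top"
  unfolding filterlim_at_top
proof
  fix Z :: real
  show "\<forall>\<^sub>F x in at_top. Z \<le> level_inv x"
    using eventually_ge_at_top[of "level 1"] eventually_ge_at_top[of "level (max 1 Z)"]
  proof eventually_elim
    case (elim x)
    then show ?case using level_inv_less_iff[of x "max 1 Z"] by (simp add: max_def split: if_splits)
  qed
qed

section \<open>The Stieltjes transform and de Haan's class\<close>

text \<open>For \<open>m < l\<close> close to \<open>l\<close>, \<open>level(m y) < l level(y)\<close> eventually; at \<open>y = level_inv x\<close> this reads
\<open>m level_inv(x) < level_inv(lx)\<close>. The upper bound is symmetric.\<close>

lemma level_inv_ratio: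
  assumes level: "\<And>l. l > 0 \<Longrightarrow> ((\<lambda>y. level (l * y) / level y) \<longlongrightarrow> l) at_top" and l: "l > 0"
  shows "((\<lambda>x. level_inv (l * x) / level_inv x) \<longlongrightarrow> l) at_top"
proof -
  have lx: "filterlim (\<lambda>x. l * x) at_top at_top" using l by real_asymp
  have dom: "\<forall>\<^sub>F x in at_top. x \<ge> level 1 \<and> l * x \<ge> level 1"
    by (intro eventually_conj eventually_ge_at_top eventually_compose_filterlim[OF eventually_ge_at_top lx])
  have near: "((\<lambda>x. level (m * level_inv x) / level (level_inv x)) \<longlongrightarrow> m) at_top" if "m > 0" for m
    using filterlim_compose[OF level[OF that] level_inv_at_top] .
  show ?thesis
  proof (rule order_tendstoI)
    fix a assume a: "a < l"
    \<comment> \<open>\<open>a\<close> may be negative, but the ratio \<open>m\<close> must be positive\<close>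
    define m where "m = (max a 0 + l) / 2"
    have m: "a < m" "0 < m" "m < l" using a l by (auto simp: m_def max_def)
    show "\<forall>\<^sub>F x in at_top. a < level_inv (l * x) / level_inv x"
      using order_tendstoD(2)[OF near[OF m(2)] m(3)] dom
    proof eventually_elim
      case (elim x)
      note p = level_inv_props[OF conjunct1[OF elim(2)]]
      have x0: "x > 0" using elim level_gt_1[of 1] by simp
      have "level (m * level_inv x) < l * x" using elim p x0 by (simp add: divide_less_eq)
      then have "m * level_inv x < level_inv (l * x)"
        using elim m p by (subst level_inv_gt_iff) auto
      then have "m < level_inv (l * x) / level_inv x" using p by (simp add: less_divide_eq)
      then show ?case using m by simp
    qed
  next
    fix b assume b: "l < b"
    define m where "m = (b + l) / 2"
    have m: "m < b" "0 < m" "l < m" using b l by (auto simp: m_def)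
    show "\<forall>\<^sub>F x in at_top. level_inv (l * x) / level_inv x < b"
      using order_tendstoD(1)[OF near[OF m(2)] m(3)] dom
    proof eventually_elim
      case (elim x)
      note p = level_inv_props[OF conjunct1[OF elim(2)]]
      have x0: "x > 0" using elim level_gt_1[of 1] by simp
      have "l * x < level (m * level_inv x)" using elim p x0 by (simp add: less_divide_eq)
      then have "level_inv (l * x) < m * level_inv x"
        using elim m p by (subst level_inv_less_iff) auto
      then have "level_inv (l * x) / level_inv x < m" using p by (simp add: divide_less_eq)
      then show ?case using m by simp
    qed
  qed
qed

lemma parallel_mean_level_inv:
  assumes "x \<ge> level 1"
  shows "parallel_mean (level_inv x) = level_inv x / x"
proof -
  have p: "level (level_inv x) = x" "level_inv x \<ge> 1" using level_inv_props[OF assms] .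
  then have "x * parallel_mean (level_inv x) = level_inv x"
    using parallel_mean_pos[of "level_inv x"] by (simp add: level_def field_simps)
  moreover have "x > 0" using assms level_gt_1[of 1] by simp
  ultimately show ?thesis by (simp add: field_simps)
qed

text \<open>Composing a Lebesgue measurable function with a continuous one can destroy measurability. Here the preimages
under \<open>level_inv\<close> are images under the locally Lipschitz function \<open>level\<close>.\<close>

lemma measurable_compose_level_inv:
  fixes L :: "real \<Rightarrow> real"
  assumes L: "L \<in> borel_measurable (lebesgue_on {a..})" and b: "1 \<le> b" "a \<le> b"
  shows "(\<lambda>x. L (level_inv x)) \<in> borel_measurable (lebesgue_on {level b..})"
proof (rule borel_measurableI_less)
  fix c :: real
  define T where "T = {y \<in> {b..}. L y < c}"
  have "{y \<in> space (lebesgue_on {a..}). L y < c} \<in> sets (lebesgue_on {a..})"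
    using L by measurable
  then have "{y \<in> {a..}. L y < c} \<in> sets lebesgue"
    by (simp add: sets_restrict_space_iff)
  then have "{y \<in> {a..}. L y < c} \<inter> {b..} \<in> sets lebesgue" by (intro sets.Int) auto
  moreover have "{y \<in> {a..}. L y < c} \<inter> {b..} = T" using b by (auto simp: T_def)
  ultimately have T: "T \<in> sets lebesgue" by simp
  have "level ` T \<in> sets lebesgue"
  proof (rule sets_lebesgue_continuous_image[OF T level_continuous])
    fix N :: "real set" assume N: "negligible N" "N \<subseteq> {1..}"
    show "negligible (level ` N)"
    proof (rule negligible_locally_Lipschitz_image[OF _ N(1)])
      fix x assume x: "x \<in> N"
      have "norm (level y - level x) \<le> (level (x + 1))\<^sup>2 * norm (y - x)"
        if "y \<in> N \<inter> ball x 1" for y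
        using that x N(2) by (auto simp: dist_real_def intro!: level_Lipschitz)
      then show "\<exists>T B. open T \<and> x \<in> T \<and> (\<forall>y\<in>N \<inter> T. norm (level y - level x) \<le> B * norm (y - x))"
        by (intro exI[of _ "ball x 1"] exI[of _ "(level (x + 1))\<^sup>2"]) auto
    qed simp
  qed (use b in \<open>auto simp: T_def\<close>)
  moreover have "{x \<in> {level b..}. L (level_inv x) < c} = level ` T"
  proof (intro equalityI subsetI)
    fix x assume x: "x \<in> {x \<in> {level b..}. L (level_inv x) < c}"
    have "level 1 \<le> level b" using level_less_iff[of b 1] b by auto
    then have p: "level (level_inv x) = x" "level_inv x \<ge> 1" using level_inv_props[of x] x by auto
    have "level_inv x \<ge> b" using level_less_iff[of "level_inv x" b] p x b by auto
    then show "x \<in> level ` T" using x p by (intro image_eqI[of _ _ "level_inv x"]) (auto simp: T_def)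
  next
    fix x assume "x \<in> level ` T"
    then obtain y where y: "y \<ge> b" "L y < c" "x = level y" by (auto simp: T_def)
    then show "x \<in> {x \<in> {level b..}. L (level_inv x) < c}"
      using level_less_iff[of y b] level_inv_level[of y] b by auto
  qed
  moreover have "level ` T \<subseteq> {level b..}"
    using level_less_iff[of _ b] b by (force simp: T_def not_less[symmetric])
  ultimately show "{x \<in> space (lebesgue_on {level b..}). L (level_inv x) < c} \<in> sets (lebesgue_on {level b..})"
    by (simp add: sets_restrict_space_iff)
qed

text \<open>With \<open>Y = level_inv\<close> and \<open>H = parallel_mean \<circ> Y\<close>, the function in question is
\<open>Y(x)/(x-1) = H(x) + H(x)/(x-1)\<close>. The asymptotics of \<open>H\<close> come from those of \<open>parallel_mean\<close> because
\<open>Y(lx)/Y(x)\<close> tends to \<open>l\<close>, and the last summand is \<open>o(M(x))\<close>. That \<open>M\<close> varies slowly is seen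
from \<open>L(y) \<sim> y stieltjes 0 y\<close>, where \<open>stieltjes 0\<close> is monotone.\<close>

lemma Pi_of_stieltjes:
  assumes L: "L \<in> slowly_varying" and dens: "((\<lambda>y. y * stieltjes 0 y / L y) \<longlongrightarrow> 1) at_top"
  shows "(\<lambda>x. level_inv x / (x - 1)) \<in> Pi_class (\<lambda>x. L (level_inv x)) 1"
proof -
  obtain a where meas: "L \<in> borel_measurable (lebesgue_on {a..})" and pos: "\<And>x. x \<ge> a \<Longrightarrow> L x > 0"
    using L by (auto simp: slowly_varying_def)
  have slow: "((\<lambda>x. L (l * x) / L x) \<longlongrightarrow> 1) at_top" if "l > 0" for l
    using L that by (auto simp: slowly_varying_def)
  have ev_pos: "\<forall>\<^sub>F x in at_top. L x > 0"
    using eventually_ge_at_top[of a] by eventually_elim (rule pos)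
  define Y where "Y = level_inv"
  define M where "M = (\<lambda>x. L (Y x))"
  define H where "H = (\<lambda>x. parallel_mean (Y x))"
  have Y: "filterlim Y at_top at_top" unfolding Y_def by (rule level_inv_at_top)
  have Y1: "Y x \<ge> 1" "level (Y x) = x" if "x \<ge> level 1" for x
    unfolding Y_def using level_inv_props[OF that] by auto
  have M_pos: "\<forall>\<^sub>F x in at_top. M x > 0"
    unfolding M_def using ev_pos Y by (rule eventually_compose_filterlim)
  have scaled: "filterlim (\<lambda>x. l * x) at_top at_top" if "l > 0" for l :: real
    using that by real_asymp
  have parallel_mean_Pi: "((\<lambda>y. (parallel_mean (l * y) - parallel_mean y) / L y) \<longlongrightarrow> ln l) at_top" if "l > 0" for l
    by (rule Pi_of_density[OF parallel_mean_increment(2,1) ev_pos slow dens that])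
  have parallel_mean_slow: "((\<lambda>y. parallel_mean (l * y) / parallel_mean y) \<longlongrightarrow> 1) at_top" if "l > 0" for l
    by (rule Pi_imp_slow_variation[OF _ ev_pos parallel_mean_Pi that])
      (use eventually_gt_at_top[of 0] in eventually_elim, rule parallel_mean_pos)
  have Y_ratio: "((\<lambda>x. Y (l * x) / Y x) \<longlongrightarrow> l) at_top" if l: "l > 0" for l
    unfolding Y_def
  proof (rule level_inv_ratio[OF _ l])
    fix m :: real assume m: "m > 0"
    have "((\<lambda>y. m / (parallel_mean (m * y) / parallel_mean y)) \<longlongrightarrow> m / 1) at_top"
      using m by (intro tendsto_intros parallel_mean_slow) auto
    moreover have "\<forall>\<^sub>F y in at_top. m / (parallel_mean (m * y) / parallel_mean y) = level (m * y) / level y"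
      using eventually_gt_at_top[of 0] by eventually_elim (simp add: level_def)
    ultimately show "((\<lambda>y. level (m * y) / level y) \<longlongrightarrow> m) at_top"
      using Lim_transform_eventually by fastforce
  qed
  have Y_pos: "\<forall>\<^sub>F x in at_top. Y x > 0"
    using Y by (auto simp: filterlim_at_top_dense)
  have stieltjes_ratio: "((\<lambda>y. stieltjes 0 (m * y) / stieltjes 0 y) \<longlongrightarrow> 1 / m) at_top" if m: "m > 0" for m
  proof -
    have "((\<lambda>y. (m * y * stieltjes 0 (m * y) / L (m * y)) / (y * stieltjes 0 y / L y) * (L (m * y) / L y) / m)
        \<longlongrightarrow> 1 / 1 * 1 / m) at_top"
      using m by (intro tendsto_mult tendsto_divide tendsto_const slow dens filterlim_compose[OF dens scaled]) auto
    moreover have "\<forall>\<^sub>F y in at_top. L (m * y) > 0"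
      using ev_pos scaled[OF m] by (rule eventually_compose_filterlim)
    then have "\<forall>\<^sub>F y in at_top. (m * y * stieltjes 0 (m * y) / L (m * y)) / (y * stieltjes 0 y / L y) * (L (m * y) / L y) / m
        = stieltjes 0 (m * y) / stieltjes 0 y"
      using ev_pos eventually_gt_at_top[of 0] by eventually_elim (use m in simp)
    ultimately show ?thesis using Lim_transform_eventually by fastforce
  qed
  have M_slow: "((\<lambda>x. M (l * x) / M x) \<longlongrightarrow> 1) at_top" if l: "l > 0" for l
  proof -
    \<comment> \<open>the sign turns the decreasing function into an increasing one\<close>
    have "((\<lambda>x. - (stieltjes 0 (Y (l * x) / Y x * Y x) / stieltjes 0 (Y x))) \<longlongrightarrow> - (1 / l)) at_top"
    proof (rule tendsto_compose_monotone_family[where \<Phi> = "\<lambda>m x. - (stieltjes 0 (m * Y x) / stieltjes 0 (Y x))"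
          and \<phi> = "\<lambda>m. - (1 / m)"])
      show "((\<lambda>x. - (stieltjes 0 (m * Y x) / stieltjes 0 (Y x))) \<longlongrightarrow> - (1 / m)) at_top" if "m > 0" for m
        by (intro tendsto_minus filterlim_compose[OF stieltjes_ratio[OF that] Y])
      show "\<forall>\<^sub>F x in at_top. mono_on {0<..} (\<lambda>m. - (stieltjes 0 (m * Y x) / stieltjes 0 (Y x)))"
        using Y_pos
      proof eventually_elim
        case (elim x)
        have "stieltjes 0 (n * Y x) \<le> stieltjes 0 (m * Y x)" if "0 < m" "m \<le> n" for m n
        proof (cases "m = n")
          case False
          have "0 \<le> (n * Y x - m * Y x) * (real (0 + 2) * stieltjes (Suc 0) (n * Y x))"
            using that elim stieltjes_pos[of "n * Y x" "Suc 0"] by (intro mult_nonneg_nonneg) auto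
          moreover have "0 < m * Y x" "m * Y x < n * Y x" using that elim False by auto
          ultimately show ?thesis using stieltjes_increment(1)[of "m * Y x" "n * Y x" 0] by linarith
        qed simp
        then show ?case using stieltjes_pos[OF elim, of 0] by (intro mono_onI) (simp add: divide_right_mono)
      qed
      show "isCont (\<lambda>m. - (1 / m)) l" using l by (intro continuous_intros) auto
    qed (use l Y_ratio in auto)
    then have mom: "((\<lambda>x. stieltjes 0 (Y (l * x) / Y x * Y x) / stieltjes 0 (Y x)) \<longlongrightarrow> 1 / l) at_top"
      using tendsto_minus by fastforce
    have dY: "((\<lambda>x. Y x * stieltjes 0 (Y x) / M x) \<longlongrightarrow> 1) at_top"
      unfolding M_def using filterlim_compose[OF dens Y] .
    have dYl: "((\<lambda>x. Y (l * x) * stieltjes 0 (Y (l * x)) / M (l * x)) \<longlongrightarrow> 1) at_top"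
      using filterlim_compose[OF dY scaled[OF l]] .
    have "((\<lambda>x. (Y x * stieltjes 0 (Y x) / M x) / (Y (l * x) * stieltjes 0 (Y (l * x)) / M (l * x))
          * (Y (l * x) / Y x) * (stieltjes 0 (Y (l * x) / Y x * Y x) / stieltjes 0 (Y x))) \<longlongrightarrow> 1 / 1 * l * (1 / l)) at_top"
      by (intro tendsto_mult tendsto_divide dY dYl Y_ratio l mom) auto
    moreover have "\<forall>\<^sub>F x in at_top. (Y x * stieltjes 0 (Y x) / M x) / (Y (l * x) * stieltjes 0 (Y (l * x)) / M (l * x))
          * (Y (l * x) / Y x) * (stieltjes 0 (Y (l * x) / Y x * Y x) / stieltjes 0 (Y x)) = M (l * x) / M x"
      using Y_pos eventually_compose_filterlim[OF Y_pos scaled[OF l]]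
    proof eventually_elim
      case (elim x)
      then show ?case using stieltjes_pos[of "Y x" 0] stieltjes_pos[of "Y (l * x)" 0] by simp
    qed
    ultimately show ?thesis using l Lim_transform_eventually by fastforce
  qed
  have M_sv: "M \<in> slowly_varying"
  proof -
    \<comment> \<open>beyond \<open>level b\<close> both the inverse is defined and \<open>L\<close> is positive\<close>
    define b where "b = max 1 a"
    have b: "1 \<le> b" "a \<le> b" by (auto simp: b_def)
    have "M x > 0" if x: "x \<ge> level b" for x
    proof -
      have "level 1 \<le> level b" using level_less_iff[of b 1] b by auto
      then have "level (Y x) = x" "Y x \<ge> 1" using Y1[of x] x by auto
      then have "Y x \<ge> b" using level_less_iff[of "Y x" b] x b by auto
      then show ?thesis unfolding M_def using b by (intro pos) simp
    qed
    then show ?thesis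
      using M_slow measurable_compose_level_inv[OF meas b]
      unfolding slowly_varying_def M_def Y_def by blast
  qed
  have H_Pi: "((\<lambda>x. (H (l * x) - H x) / M x) \<longlongrightarrow> ln l) at_top" if l: "l > 0" for l
  proof -
    have "((\<lambda>x. (parallel_mean (Y (l * x) / Y x * Y x) - parallel_mean (Y x)) / L (Y x)) \<longlongrightarrow> ln l) at_top"
    proof (rule tendsto_compose_monotone_family[where \<Phi> = "\<lambda>m x. (parallel_mean (m * Y x) - parallel_mean (Y x)) / L (Y x)"
          and \<phi> = ln])
      show "((\<lambda>x. (parallel_mean (m * Y x) - parallel_mean (Y x)) / L (Y x)) \<longlongrightarrow> ln m) at_top" if "m > 0" for m
        by (rule filterlim_compose[OF parallel_mean_Pi[OF that] Y])
      show "\<forall>\<^sub>F x in at_top. mono_on {0<..} (\<lambda>m. (parallel_mean (m * Y x) - parallel_mean (Y x)) / L (Y x))"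
        using Y_pos M_pos
        by eventually_elim (auto intro!: mono_onI divide_right_mono parallel_mean_mono simp: M_def)
      show "isCont ln l" using l by (intro continuous_intros) auto
    qed (use l Y_ratio in auto)
    moreover have "\<forall>\<^sub>F x in at_top. (parallel_mean (Y (l * x) / Y x * Y x) - parallel_mean (Y x)) / L (Y x)
        = (H (l * x) - H x) / M x"
      using Y_pos by eventually_elim (simp add: H_def M_def)
    ultimately show ?thesis using Lim_transform_eventually by fastforce
  qed
  have H_small: "((\<lambda>x. H x / (x * M x)) \<longlongrightarrow> 0) at_top"
  proof (rule Pi_small_over_identity[OF _ M_pos _ H_Pi])
    show "\<forall>\<^sub>F x in at_top. H x > 0"
      unfolding H_def using Y_pos by eventually_elim (rule parallel_mean_pos)
    show "mono_on {level 1..} H"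
      unfolding H_def using Y1 level_inv_mono
      by (intro mono_onI parallel_mean_mono) (auto simp: Y_def intro: less_le_trans[OF zero_less_one])
  qed
  have f_Pi: "((\<lambda>x. (Y (l * x) / (l * x - 1) - Y x / (x - 1)) / M x) \<longlongrightarrow> ln l) at_top" if l: "l > 0" for l
  proof -
    have r: "((\<lambda>x. l * x / (l * x - 1)) \<longlongrightarrow> 1) at_top" "((\<lambda>x::real. x / (x - 1)) \<longlongrightarrow> 1) at_top"
      using l by real_asymp+
    have "((\<lambda>x. (H (l * x) - H x) / M x
          + H (l * x) / (l * x * M (l * x)) * (M (l * x) / M x) * (l * x / (l * x - 1))
          - H x / (x * M x) * (x / (x - 1))) \<longlongrightarrow> ln l + 0 * 1 * 1 - 0 * 1) at_top"
      by (intro tendsto_add tendsto_diff tendsto_mult H_Pi l r M_slow H_small filterlim_compose[OF H_small scaled])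
    moreover have "\<forall>\<^sub>F x in at_top. (H (l * x) - H x) / M x
          + H (l * x) / (l * x * M (l * x)) * (M (l * x) / M x) * (l * x / (l * x - 1))
          - H x / (x * M x) * (x / (x - 1)) = (Y (l * x) / (l * x - 1) - Y x / (x - 1)) / M x"
      using M_pos eventually_compose_filterlim[OF M_pos scaled[OF l]] eventually_ge_at_top[of "level 1"]
        eventually_compose_filterlim[OF eventually_ge_at_top[of "level 1"] scaled[OF l]]
    proof eventually_elim
      case (elim x)
      have gt: "x > 1" "l * x > 1" using elim level_gt_1[of 1] by auto
      have Yx: "Y x = x * H x" "Y (l * x) = l * x * H (l * x)"
        using parallel_mean_level_inv elim gt by (auto simp: H_def Y_def)
      \<comment> \<open>the part \<open>h/(z-1)\<close> is the correction that \<open>H_small\<close> makes negligible\<close>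
      have split: "z * h / (z - 1) = h + h / (z - 1)" if "z > 1" for z h :: real
        using that by (simp add: field_simps)
      have 1: "H (l * x) / (l * x * M (l * x)) * (M (l * x) / M x) * (l * x / (l * x - 1)) = H (l * x) / (l * x - 1) / M x"
        using elim gt l by simp
      have 2: "H x / (x * M x) * (x / (x - 1)) = H x / (x - 1) / M x"
        using gt by simp
      show ?case unfolding 1 2 Yx split[OF gt(1)] split[OF gt(2)]
        by (simp add: diff_divide_distrib add_divide_distrib)
    qed
    ultimately show ?thesis using Lim_transform_eventually by fastforce
  qed
  show ?thesis
    using M_sv f_Pi unfolding Pi_class_def M_def Y_def by simp
qed

text \<open>Membership in the class makes \<open>f(x) = Y(x)/(x-1)\<close> slowly varying, whence \<open>Y(lx)/Y(x)\<close> tends to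
\<open>l\<close>. Then \<open>parallel_mean(Y(x)) = f(x) - f(x)/x\<close> has the increments of \<open>f\<close> up to \<open>o(M(x))\<close>, as
\<open>f\<close> is monotone, and monotone density along \<open>y = Y(x)\<close> gives the claim.\<close>

lemma stieltjes_of_Pi:
  assumes Pi: "(\<lambda>x. level_inv x / (x - 1)) \<in> Pi_class (\<lambda>x. L (level_inv x)) 1"
  shows "((\<lambda>y. y * stieltjes 0 y / L y) \<longlongrightarrow> 1) at_top"
proof -
  define Y where "Y = level_inv"
  define M where "M = (\<lambda>x. L (Y x))"
  define f where "f = (\<lambda>x. Y x / (x - 1))"
  have Y1: "Y x \<ge> 1" "level (Y x) = x" if "x \<ge> level 1" for x
    unfolding Y_def using level_inv_props[OF that] by auto
  have scaled: "filterlim (\<lambda>x. l * x) at_top at_top" if "l > 0" for l :: real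
    using that by real_asymp
  obtain a where a: "\<And>x. x \<ge> a \<Longrightarrow> M x > 0"
    using Pi by (auto simp: Pi_class_def slowly_varying_def M_def Y_def)
  have M_pos: "\<forall>\<^sub>F x in at_top. M x > 0"
    using eventually_ge_at_top[of a] by eventually_elim (rule a)
  have M_slow: "((\<lambda>x. M (l * x) / M x) \<longlongrightarrow> 1) at_top" if "l > 0" for l
    using Pi that by (auto simp: Pi_class_def slowly_varying_def M_def Y_def)
  have f_Pi: "((\<lambda>x. (f (l * x) - f x) / M x) \<longlongrightarrow> ln l) at_top" if "l > 0" for l
    using Pi that by (auto simp: Pi_class_def f_def M_def Y_def)
  have dom: "\<forall>\<^sub>F x in at_top. x \<ge> level 1 \<and> x > 1"
    by (intro eventually_conj eventually_ge_at_top eventually_gt_at_top)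
  have Y_pos: "\<forall>\<^sub>F x in at_top. Y x > 0"
    using dom by eventually_elim (use Y1 in force)
  have f_pos: "\<forall>\<^sub>F x in at_top. f x > 0"
    using dom Y_pos by eventually_elim (simp add: f_def)
  have f_eq: "f x = 1 / resolvent (Y x) - Y x" if x: "x \<ge> level 1" for x
  proof -
    have Yx: "Y x > 0" "level (Y x) = x" using Y1[OF x] by auto
    have x1: "x > 1" using level_gt_1[of 1] x by simp
    have "1 / x = 1 - Y x * resolvent (Y x)" using inverse_level[OF Yx(1)] Yx(2) by simp
    then have "Y x * resolvent (Y x) = (x - 1) / x" using x1 by (simp add: field_simps)
    then have "resolvent (Y x) = (x - 1) / (x * Y x)" using Yx x1 by (simp add: field_simps)
    then have "1 / resolvent (Y x) = x * Y x / (x - 1)" by simp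
    also have "\<dots> - Y x = f x" using x1 by (simp add: f_def field_simps)
    finally show ?thesis by simp
  qed
  have f_mono: "mono_on {level 1..} f"
  proof (rule mono_onI)
    fix r s assume rs: "r \<in> {level 1..}" "s \<in> {level 1..}" "r \<le> s"
    have "Y r \<le> Y s" unfolding Y_def using rs by (intro level_inv_mono) auto
    then show "f r \<le> f s"
      using inverse_resolvent_minus_id_mono[of "Y r" "Y s"] Y1[of r] rs by (cases "Y r = Y s") (auto simp: f_eq)
  qed
  have f_small: "((\<lambda>x. f x / (x * M x)) \<longlongrightarrow> 0) at_top"
    by (rule Pi_small_over_identity[OF f_pos M_pos f_mono f_Pi])
  have Y_ratio: "((\<lambda>x. Y (l * x) / Y x) \<longlongrightarrow> l) at_top" if l: "l > 0" for l
  proof -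
    have r: "((\<lambda>x. (l * x - 1) / (x - 1)) \<longlongrightarrow> l) at_top" using l by real_asymp
    have "((\<lambda>x. f (l * x) / f x * ((l * x - 1) / (x - 1))) \<longlongrightarrow> 1 * l) at_top"
      by (intro tendsto_mult r Pi_imp_slow_variation[OF f_pos M_pos f_Pi l])
    moreover have "\<forall>\<^sub>F x in at_top. f (l * x) / f x * ((l * x - 1) / (x - 1)) = Y (l * x) / Y x"
      using dom eventually_compose_filterlim[OF dom scaled[OF l]]
      by eventually_elim (simp add: f_def)
    ultimately show ?thesis using Lim_transform_eventually by fastforce
  qed
  have parallel_mean_Pi: "((\<lambda>x. (- parallel_mean (Y x) - - parallel_mean (Y (l * x))) / M x) \<longlongrightarrow> ln l) at_top"
    if l: "l > 0" for l
  proof -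
    have "((\<lambda>x. (f (l * x) - f x) / M x - (f (l * x) / (l * x * M (l * x)) * (M (l * x) / M x) - f x / (x * M x)))
        \<longlongrightarrow> ln l - (0 * 1 - 0)) at_top"
      by (intro tendsto_diff tendsto_mult f_Pi l M_slow f_small filterlim_compose[OF f_small scaled])
    moreover have "\<forall>\<^sub>F x in at_top.
        (f (l * x) - f x) / M x - (f (l * x) / (l * x * M (l * x)) * (M (l * x) / M x) - f x / (x * M x))
        = (- parallel_mean (Y x) - - parallel_mean (Y (l * x))) / M x"
      using M_pos eventually_compose_filterlim[OF M_pos scaled[OF l]] dom
        eventually_compose_filterlim[OF dom scaled[OF l]]
    proof eventually_elim
      case (elim x)
      have par: "parallel_mean (Y z) = f z - f z / z" if "z \<ge> level 1" "z > 1" for z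
      proof -
        have "f z - f z / z = f z * (z - 1) / z" using that by (simp add: right_diff_distrib diff_divide_distrib)
        also have "f z * (z - 1) = Y z" using that by (simp add: f_def)
        finally show ?thesis using parallel_mean_level_inv[OF that(1)] by (simp add: Y_def)
      qed
      have "f (l * x) / (l * x * M (l * x)) * (M (l * x) / M x) = f (l * x) / (l * x) / M x"
        using elim by simp
      moreover have "f x / (x * M x) = f x / x / M x" by simp
      moreover have "parallel_mean (Y x) = f x - f x / x" "parallel_mean (Y (l * x)) = f (l * x) - f (l * x) / (l * x)"
        using elim par by blast+
      ultimately show ?case by (simp add: diff_divide_distrib)
    qed
    ultimately show ?thesis using Lim_transform_eventually by fastforce
  qed
  have "((\<lambda>x. Y x * stieltjes 0 (Y x) / M x) \<longlongrightarrow> 1) at_top"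
  proof (rule monotone_density[where A = "\<lambda>y. - parallel_mean y" and B = "stieltjes 0" and \<phi> = ln
        and q = "\<lambda>l x. Y (l * x)"])
    show "(ln has_real_derivative 1) (at 1)" using DERIV_ln[of 1] by simp
  qed (use parallel_mean_increment M_pos Y_pos Y_ratio parallel_mean_Pi in auto)
  from filterlim_compose[OF this level_at_top]
  have "((\<lambda>y. Y (level y) * stieltjes 0 (Y (level y)) / M (level y)) \<longlongrightarrow> 1) at_top" .
  moreover have "\<forall>\<^sub>F y in at_top. Y (level y) * stieltjes 0 (Y (level y)) / M (level y) = y * stieltjes 0 y / L y"
    using eventually_gt_at_top[of 0] by eventually_elim (simp add: Y_def M_def level_inv_level)
  ultimately show ?thesis using Lim_transform_eventually by fastforce
qed

end

text \<open>A probability measure on \<open>[0,\<infinity>)\<close> without mass on \<open>(0,\<infinity>)\<close> is the point mass at \<open>0\<close>.\<close>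

lemma half_line_distribution_M_plus:
  assumes mu: "\<mu> \<in> M_plus" "\<mu> \<noteq> delta_zero"
  shows "half_line_distribution \<mu>"
proof -
  interpret prob_space \<mu> using mu(1) by (simp add: M_plus_def)
  have sets: "sets \<mu> = sets (restrict_space borel {0..})" using mu(1) by (simp add: M_plus_def)
  have space: "space \<mu> = {0..}"
    using sets_eq_imp_space_eq[OF sets] by (simp add: space_restrict_space)
  have pos_set: "{0<..} \<in> sets \<mu>"
    unfolding sets by (auto simp: sets_restrict_space image_iff intro!: bexI[of _ "{0<..}"])
  have "measure \<mu> {0<..} \<noteq> 0"
  proof
    assume "measure \<mu> {0<..} = 0"
    then have null: "emeasure \<mu> {0<..} = 0" by (simp add: emeasure_eq_measure)
    have "\<mu> = delta_zero"
    proof (rule measure_eqI)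
      show "sets \<mu> = sets delta_zero" by (simp add: sets delta_zero_def)
      fix A assume A: "A \<in> sets \<mu>"
      then have A0: "A \<subseteq> {0..}" using sets.sets_into_space[OF A] space by simp
      have "emeasure \<mu> A = indicator A 0"
      proof (cases "0 \<in> A")
        case True
        have "space \<mu> - A \<subseteq> {0<..}" using True A0 space by (auto simp: less_le)
        then have "emeasure \<mu> (space \<mu> - A) = 0" using null pos_set emeasure_mono by fastforce
        then have "prob (space \<mu> - A) = 0" by (simp add: emeasure_eq_measure)
        then have "prob A = 1" using prob_compl[OF A] by simp
        then show ?thesis using True by (simp add: emeasure_eq_measure)
      next
        case False
        then have "A \<subseteq> {0<..}" using A0 by (auto simp: less_le)
        then have "emeasure \<mu> A = 0" using null pos_set emeasure_mono by fastforce
        then show ?thesis using False by simp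
      qed
      then show "emeasure \<mu> A = emeasure delta_zero A"
        using A by (simp add: delta_zero_def sets)
    qed
    then show False using mu(2) by simp
  qed
  then show ?thesis
    using sets by unfold_locales (auto simp: zero_less_measure_iff)
qed

theorem theorem4p7:
  fixes \<mu> :: "real measure" and L :: "real \<Rightarrow> real"
  assumes "\<mu> \<in> M_plus" and "\<mu> \<noteq> delta_zero" and "L \<in> slowly_varying"
  shows "(\<lambda>x. measure \<mu> {x<..}) \<sim>[at_top] (\<lambda>x. inverse x * L x) \<longleftrightarrow>
    (\<lambda>x. 1 / S_transform \<mu> (- 1 / x)) \<in> Pi_class (\<lambda>x. L ((x - 1) / S_transform \<mu> (- 1 / x))) 1"
proof -
  interpret half_line_distribution \<mu> by (rule half_line_distribution_M_plus) fact+
  obtain a where pos: "\<And>x. x \<ge> a \<Longrightarrow> L x > 0"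
    using assms(3) by (auto simp: slowly_varying_def)
  have ev_pos: "\<forall>\<^sub>F x in at_top. L x > 0"
    using eventually_ge_at_top[of a] by eventually_elim (rule pos)
  have slow: "((\<lambda>x. L (l * x) / L x) \<longlongrightarrow> 1) at_top" if "l > 0" for l
    using assms(3) that by (auto simp: slowly_varying_def)
  have "(\<lambda>x. measure \<mu> {x<..}) \<sim>[at_top] (\<lambda>x. inverse x * L x)
      \<longleftrightarrow> ((\<lambda>x. tail x / (inverse x * L x)) \<longlongrightarrow> 1) at_top"
    unfolding asymp_equiv_def
  proof (rule tendsto_cong)
    show "\<forall>\<^sub>F x in at_top. (if measure \<mu> {x<..} = 0 \<and> inverse x * L x = 0 then 1
        else measure \<mu> {x<..} / (inverse x * L x)) = tail x / (inverse x * L x)"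
      using ev_pos eventually_gt_at_top[of 0] by eventually_elim (simp add: tail_def)
  qed
  also have "\<dots> \<longleftrightarrow> ((\<lambda>y. y * tail y / L y) \<longlongrightarrow> 1) at_top"
    by (simp add: field_simps)
  also have "\<dots> \<longleftrightarrow> ((\<lambda>y. y * stieltjes 0 y / L y) \<longlongrightarrow> 1) at_top"
    by (rule tail_iff_stieltjes[OF ev_pos slow])
  also have "\<dots> \<longleftrightarrow> (\<lambda>x. level_inv x / (x - 1)) \<in> Pi_class (\<lambda>x. L (level_inv x)) 1"
    using Pi_of_stieltjes[OF assms(3)] stieltjes_of_Pi by blast
  also have "\<dots> \<longleftrightarrow> (\<lambda>x. 1 / S_transform \<mu> (- 1 / x)) \<in> Pi_class (\<lambda>x. L ((x - 1) / S_transform \<mu> (- 1 / x))) 1"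
  proof -
    have ev: "\<forall>\<^sub>F x in at_top. level_inv x / (x - 1) = 1 / S_transform \<mu> (- 1 / x)"
      using eventually_gt_at_top[of 1] by eventually_elim (simp add: level_inv_def)
    have "((\<lambda>x. (level_inv (l * x) / (l * x - 1) - level_inv x / (x - 1)) / M x) \<longlongrightarrow> c) at_top \<longleftrightarrow>
        ((\<lambda>x. (1 / S_transform \<mu> (- 1 / (l * x)) - 1 / S_transform \<mu> (- 1 / x)) / M x) \<longlongrightarrow> c) at_top"
      if l: "l > 0" for l c and M :: "real \<Rightarrow> real"
    proof (rule filterlim_cong[OF refl refl])
      have lx: "filterlim (\<lambda>x. l * x) at_top at_top" using l by real_asymp
      show "\<forall>\<^sub>F x in at_top. (level_inv (l * x) / (l * x - 1) - level_inv x / (x - 1)) / M x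
          = (1 / S_transform \<mu> (- 1 / (l * x)) - 1 / S_transform \<mu> (- 1 / x)) / M x"
        using ev eventually_compose_filterlim[OF ev lx] by eventually_elim simp
    qed
    then show ?thesis unfolding Pi_class_def level_inv_def by simp
  qed
  finally show ?thesis .
qed

end
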